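(* Let $\Delta$ be the $2$-dimensional simplicial complex on the nine vertices $a_1,a_2,a_3,b_1,b_2,b_3,c_1,c_2,c_3$ generated by the following $16$ triangles: $\{a_2,b_2,c_2\}$, $\{a_2,b_3,c_3\}$, $\{a_3,b_2,c_3\}$, $\{a_3,b_3,c_2\}$, $\{a_1,b_2,c_2\}$, $\{a_1,b_2,c_3\}$, $\{a_1,b_3,c_2\}$, $\{a_1,b_3,c_3\}$, $\{a_2,b_1,c_2\}$, $\{a_2,b_1,c_3\}$, $\{a_3,b_1,c_2\}$, $\{a_3,b_1,c_3\}$, $\{a_2,b_2,c_1\}$, $\{a_2,b_3,c_1\}$, $\{a_3,b_2,c_1\}$, $\{a_3,b_3,c_1\}$. Its $f$-vector is $(f_{-1},f_0,f_1,f_2)=(1,9,24,16)$. Then $\Delta$ is a vertex minimal, and hence every $f_i$ minimal, balanced triangulation of the real projective plane $\mathbb{R}\mathbf{P}^2$; that is, $\Delta$ is a balanced triangulation of $\mathbb{R}\mathbf{P}^2$, and every balanced triangulation $\Gamma$ of $\mathbb{R}\mathbf{P}^2$ satisfies $f_i(\Gamma)\ge f_i(\Delta)$ for $i=0,1,2$.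
   Context: All simplicial complexes are finite abstract simplicial complexes; the complex generated by a collection of sets consists of all subsets of those sets. $f_i(\Delta)$ denotes the number of $i$-dimensional faces (faces with $i+1$ vertices) of $\Delta$, with $f_{-1}(\Delta)=1$ for the empty face. A triangulation of a topological space $X$ is a simplicial complex whose geometric realization is homeomorphic to $X$. A $2$-dimensional simplicial complex is balanced if there is a map $\kappa$ from its vertex set to $\{1,2,3\}$ with $\kappa(i)\neq\kappa(j)$ for every edge $\{i,j\}$. *)

theory Defs
  imports "HOL-Analysis.Analysis"
begin

text \<open>A complex is the set of its faces. The empty face always belongs to it, and the
  vertex set is the union of the faces, so there are no ghost vertices.\<close>

definition abstract_simplicial_complex :: "'a set set \<Rightarrow> bool" where
  "abstract_simplicial_complex K \<longleftrightarrow>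
     finite K \<and> {} \<in> K \<and> (\<forall>\<sigma>\<in>K. finite \<sigma>) \<and> (\<forall>\<sigma>\<in>K. \<forall>\<tau>. \<tau> \<subseteq> \<sigma> \<longrightarrow> \<tau> \<in> K)"

definition vertices :: "'a set set \<Rightarrow> 'a set" where
  "vertices K = \<Union>K"

definition complex_generated_by :: "'a set set \<Rightarrow> 'a set set" where
  "complex_generated_by F = {\<sigma>. \<exists>\<tau>\<in>F. \<sigma> \<subseteq> \<tau>}"

definition face_dim :: "'a set \<Rightarrow> int" where
  "face_dim \<sigma> = int (card \<sigma>) - 1"

definition complex_dim :: "'a set set \<Rightarrow> int" where
  "complex_dim K = Max (face_dim ` K)"

definition f_number :: "int \<Rightarrow> 'a set set \<Rightarrow> nat" where
  "f_number i K = card {\<sigma>\<in>K. face_dim \<sigma> = i}"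

text \<open>Barycentric coordinates are extended by 0 to the whole vertex type. As complexes are
  finite, the topology of pointwise convergence is the usual topology of the realization.\<close>

definition geometric_realization :: "'a set set \<Rightarrow> ('a \<Rightarrow> real) topology" where
  "geometric_realization K =
     subtopology (powertop_real UNIV)
       {x. (\<forall>v. 0 \<le> x v) \<and> {v. x v \<noteq> 0} \<in> K \<and> (\<Sum>v\<in>vertices K. x v) = 1}"

definition triangulation_of :: "'a set set \<Rightarrow> 'b topology \<Rightarrow> bool" where
  "triangulation_of K X \<longleftrightarrow>
     abstract_simplicial_complex K \<and> geometric_realization K homeomorphic_space X"

definition balanced :: "'a set set \<Rightarrow> bool" where
  "balanced K \<longleftrightarrow> complex_dim K = 2 \<and>
     (\<exists>\<kappa> :: 'a \<Rightarrow> nat. \<kappa> \<in> vertices K \<rightarrow> {1, 2, 3} \<and>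
        (\<forall>i j. i \<noteq> j \<and> {i, j} \<in> K \<longrightarrow> \<kappa> i \<noteq> \<kappa> j))"

definition quotient_topology :: "'a topology \<Rightarrow> ('a \<Rightarrow> 'b) \<Rightarrow> 'b topology" where
  "quotient_topology X q =
     topology (\<lambda>U. U \<subseteq> q ` topspace X \<and> openin X {x \<in> topspace X. q x \<in> U})"

lemma openin_quotient_topology:
  "openin (quotient_topology X q) U \<longleftrightarrow>
     U \<subseteq> q ` topspace X \<and> openin X {x \<in> topspace X. q x \<in> U}"
proof -
  have "istopology (\<lambda>U. U \<subseteq> q ` topspace X \<and> openin X {x \<in> topspace X. q x \<in> U})"
    (is "istopology ?P")
    unfolding istopology_def
  proof (intro conjI allI impI)
    fix S T assume "?P S" "?P T"
    moreover have "{x \<in> topspace X. q x \<in> S \<inter> T} =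
        {x \<in> topspace X. q x \<in> S} \<inter> {x \<in> topspace X. q x \<in> T}" by blast
    ultimately show "S \<inter> T \<subseteq> q ` topspace X" "openin X {x \<in> topspace X. q x \<in> S \<inter> T}"
      by (auto simp: openin_Int)
  next
    fix \<K> assume *: "\<forall>K\<in>\<K>. ?P K"
    then show "\<Union>\<K> \<subseteq> q ` topspace X" by blast
    have "{x \<in> topspace X. q x \<in> \<Union>\<K>} = (\<Union>K\<in>\<K>. {x \<in> topspace X. q x \<in> K})" by blast
    with * show "openin X {x \<in> topspace X. q x \<in> \<Union>\<K>}" by auto
  qed
  then show ?thesis
    by (simp add: quotient_topology_def)
qed

lemma topspace_quotient_topology [simp]:
  "topspace (quotient_topology X q) = q ` topspace X"
proof
  show "topspace (quotient_topology X q) \<subseteq> q ` topspace X"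
    by (metis openin_quotient_topology openin_topspace)
  have "{x \<in> topspace X. q x \<in> q ` topspace X} = topspace X" by blast
  then have "openin (quotient_topology X q) (q ` topspace X)"
    by (simp add: openin_quotient_topology)
  then show "q ` topspace X \<subseteq> topspace (quotient_topology X q)"
    by (rule openin_subset)
qed

lemma quotient_map_quotient_topology: "quotient_map X (quotient_topology X q) q"
  by (simp add: quotient_map_def openin_quotient_topology)

text \<open>The unit sphere with antipodal points identified.\<close>

definition real_projective_plane :: "(real ^ 3) set topology" where
  "real_projective_plane = quotient_topology (top_of_set (sphere 0 1)) (\<lambda>x. {x, - x})"

datatype vertex = a1 | a2 | a3 | b1 | b2 | b3 | c1 | c2 | c3

definition \<Delta> :: "vertex set set" where
  "\<Delta> = complex_generated_by
     {{a2, b2, c2}, {a2, b3, c3}, {a3, b2, c3}, {a3, b3, c2},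
      {a1, b2, c2}, {a1, b2, c3}, {a1, b3, c2}, {a1, b3, c3},
      {a2, b1, c2}, {a2, b1, c3}, {a3, b1, c2}, {a3, b1, c3},
      {a2, b2, c1}, {a2, b3, c1}, {a3, b2, c1}, {a3, b3, c1}}"

end

theory Submission
  imports Defs
begin

text \<open>
  That \<Delta> triangulates the projective plane is seen on the octahedron
  \<open>\<bar>x\<bar> + \<bar>y\<bar> + \<bar>z\<bar> = 1\<close> with every face cut into four triangles by the midpoints of its edges.
  This is a centrally symmetric triangulation of the sphere with 18 vertices and 32 triangles.
  Identifying antipodes turns the corners on the three axes into \<open>a1\<close>, \<open>b1\<close>, \<open>c1\<close>, the twelve
  edge midpoints into the other six vertices, and the triangles into the 16 facets of \<Delta>. The
  barycentric coordinates of a point in this triangulation are even, piecewise linear functions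
  (\<open>weight\<close>), so sphere points map to points of \<Delta>, and two points have the same image iff they
  are antipodal or equal: both spaces are quotients of the sphere with the same fibres.

  The lower bounds rest on two facts about the projective plane. It is locally the plane, so by
  invariance of domain every edge of a triangulation lies in exactly two triangles (\<open>edge_has_two_apexes\<close>,
  \<open>edge_has_at_most_two_apexes\<close>). And the double covering by the sphere has no continuous section,
  because the sphere is connected (\<open>no_global_lift\<close>). Over a cone there is a section, and sections
  over two closed sets glue, after a change of sign, if the sets meet in a connected set
  (\<open>lift_on_closed_star\<close>, \<open>lift_on_Un\<close>). Now fix a colour. The closed stars of its vertices are
  cones, they cover the complex, and each meets the union of the others in its link
  (\<open>closed_star_Int_others\<close>). So a balanced triangulation cannot have so few vertices of a colour
  that its stars can be glued along connected intersections.

  The count is as follows. All pairs of colours span the same number \<open>e\<close> of edges, and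
  \<open>f\<^sub>1 = 3 e\<close>, \<open>f\<^sub>2 = 2 e\<close>. A vertex has equally many neighbours in each of the other two
  colours, and at least two of them; if it has at most three in each, its link is connected. Each
  colour has at least two vertices. If it has exactly two, both are adjacent to all vertices of the other
  colours, of which there are then \<open>n\<close> each, and \<open>f\<^sub>0 = 2 + 2 n\<close>, \<open>f\<^sub>2 = 4 n\<close>; for \<open>n \<le> 3\<close> the
  two stars would meet in a connected link, so \<open>n \<ge> 4\<close>. If each colour has at least three vertices,
  then \<open>f\<^sub>0 \<ge> 9\<close>, and \<open>f\<^sub>2 < 16\<close> would mean \<open>e \<le> 7\<close>. Then each colour has exactly three
  vertices, and two of the three vertices of one colour have just two neighbours in each other
  colour. Their links are complete bipartite on 2 + 2 of the 3 + 3 remaining vertices, hence their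
  stars meet in a nonempty complete bipartite graph, which is connected, and the third star meets
  the union of these two in its own connected link: a contradiction.
\<close>

section \<open>The sphere as a double cover of the projective plane\<close>

lemma homeomorphic_space_quotients_same_fibres:
  assumes f: "quotient_map X Y f" and g: "quotient_map X Z g"
    and fib: "\<And>x y. x \<in> topspace X \<Longrightarrow> y \<in> topspace X \<Longrightarrow> f x = f y \<longleftrightarrow> g x = g y"
  shows "Y homeomorphic_space Z"
proof -
  obtain h where h: "continuous_map Y Z h" "\<And>x. x \<in> topspace X \<Longrightarrow> h (f x) = g x"
    using quotient_map_lift_exists[OF f quotient_imp_continuous_map[OF g]] fib by metis
  obtain k where k: "continuous_map Z Y k" "\<And>x. x \<in> topspace X \<Longrightarrow> k (g x) = f x"
    using quotient_map_lift_exists[OF g quotient_imp_continuous_map[OF f]] fib by metis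
  have "homeomorphic_maps Y Z h k"
    unfolding homeomorphic_maps_def
    using h k quotient_imp_surjective_map[OF f] quotient_imp_surjective_map[OF g]
    by (metis imageE)
  then show ?thesis
    using homeomorphic_space_def by blast
qed

text \<open>The matrix \<open>x x\<^sup>T\<close>. It determines \<open>x\<close> up to sign, so it embeds the projective plane into a
Euclidean space, and the double covering becomes a map between subsets of normed spaces.\<close>

definition veronese :: "real^3 \<Rightarrow> real^3^3" where
  "veronese x = (\<chi> i j. x $ i * x $ j)"

abbreviation unit_sphere :: "(real^3) set" where
  "unit_sphere \<equiv> sphere 0 1"

definition veronese_surface :: "(real^3^3) set" where
  "veronese_surface = veronese ` unit_sphere"

lemma veronese_minus [simp]: "veronese (- x) = veronese x"
  by (simp add: veronese_def)

text \<open>Applying the common matrix to \<open>x\<close> gives \<open>x = (y \<bullet> x) y\<close>, and the coefficient has absolute value 1.\<close>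

lemma veronese_eq_iff:
  assumes "norm x = 1" "norm y = 1"
  shows "veronese x = veronese y \<longleftrightarrow> y = x \<or> y = - x"
proof
  assume eq: "veronese x = veronese y"
  have ij: "x $ i * x $ j = y $ i * y $ j" for i j
    using eq by (auto simp: veronese_def vec_eq_iff)
  have x1: "(\<Sum>j\<in>UNIV. x $ j * x $ j) = 1"
    using assms(1) by (simp add: norm_eq_1 inner_vec_def)
  have "x $ i = (y \<bullet> x) * y $ i" for i
  proof -
    have "x $ i = x $ i * (\<Sum>j\<in>UNIV. x $ j * x $ j)" unfolding x1 by simp
    also have "\<dots> = (\<Sum>j\<in>UNIV. (x $ i * x $ j) * x $ j)"
      by (simp add: sum_distrib_left mult.assoc)
    also have "\<dots> = (\<Sum>j\<in>UNIV. y $ i * (y $ j * x $ j))"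
      by (simp only: ij mult.assoc)
    also have "\<dots> = y $ i * (y \<bullet> x)"
      by (simp add: sum_distrib_left inner_vec_def)
    finally show ?thesis by simp
  qed
  then have x: "x = (y \<bullet> x) *\<^sub>R y" by (simp add: vec_eq_iff)
  have "norm x = \<bar>y \<bullet> x\<bar> * norm y" by (subst x) simp
  then have "y \<bullet> x = 1 \<or> y \<bullet> x = - 1" using assms by auto
  then show "y = x \<or> y = - x"
  proof
    assume "y \<bullet> x = 1"
    then have "x = y" by (subst x) simp
    then show ?thesis by simp
  next
    assume "y \<bullet> x = - 1"
    then have "x = - y" by (subst x) simp
    then show ?thesis by simp
  qed
next
  assume "y = x \<or> y = - x"
  then show "veronese x = veronese y" by (metis veronese_minus)
qed

lemma continuous_on_veronese: "continuous_on S veronese"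
  unfolding veronese_def
  by (intro continuous_on_vec_lambda continuous_on_mult continuous_on_component continuous_on_id)

lemma quotient_map_veronese:
  "quotient_map (top_of_set unit_sphere) (top_of_set veronese_surface) veronese"
proof (rule continuous_imp_quotient_map)
  show "continuous_map (top_of_set unit_sphere) (top_of_set veronese_surface) veronese"
    by (simp add: continuous_on_veronese veronese_surface_def)
qed (auto simp: compact_space_subtopology Hausdorff_space_subtopology veronese_surface_def)

lemma real_projective_plane_homeomorphic_veronese_surface:
  "real_projective_plane homeomorphic_space top_of_set veronese_surface"
  unfolding real_projective_plane_def
proof (rule homeomorphic_space_quotients_same_fibres[OF quotient_map_quotient_topology
      quotient_map_veronese])
  fix x y :: "real^3"
  assume "x \<in> topspace (top_of_set unit_sphere)" "y \<in> topspace (top_of_set unit_sphere)"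
  then show "{x, - x} = {y, - y} \<longleftrightarrow> veronese x = veronese y"
    by (auto simp: veronese_eq_iff doubleton_eq_iff)
qed

text \<open>The saturation of \<open>W\<close> is the union of \<open>W\<close> and its antipodal image, hence open.\<close>

lemma openin_veronese_image:
  assumes "openin (top_of_set unit_sphere) W"
  shows "openin (top_of_set veronese_surface) (veronese ` W)"
proof -
  have W: "W \<subseteq> unit_sphere" using assms openin_imp_subset by blast
  have "homeomorphism unit_sphere unit_sphere uminus (uminus :: real^3 \<Rightarrow> _)"
    unfolding homeomorphism_def by (auto intro!: continuous_intros image_eqI[where x="- x" for x])
  then have "openin (top_of_set unit_sphere) (uminus ` W)"
    using assms homeomorphism_imp_open_map by blast
  then have "openin (top_of_set unit_sphere) (W \<union> uminus ` W)"
    using assms by blast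
  moreover have "{x \<in> unit_sphere. veronese x \<in> veronese ` W} = W \<union> uminus ` W" (is "?L = ?R")
  proof
    show "?R \<subseteq> ?L" using W by auto
    show "?L \<subseteq> ?R"
    proof
      fix x assume "x \<in> ?L"
      then obtain w where "w \<in> W" "veronese w = veronese x" "norm x = 1" by auto
      moreover then have "norm w = 1" using W by auto
      ultimately show "x \<in> ?R" using veronese_eq_iff[of w x] by auto
    qed
  qed
  ultimately have pre: "openin (top_of_set unit_sphere) {x \<in> unit_sphere. veronese x \<in> veronese ` W}"
    by (simp only:)
  have "\<forall>U. U \<subseteq> veronese_surface \<longrightarrow>
      (openin (top_of_set unit_sphere) {x \<in> unit_sphere. veronese x \<in> U}
        \<longleftrightarrow> openin (top_of_set veronese_surface) U)"
    using quotient_map_veronese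
    unfolding quotient_map_def topspace_euclidean_subtopology by (rule conjunct2)
  moreover have "veronese ` W \<subseteq> veronese_surface"
    unfolding veronese_surface_def using W by blast
  ultimately show ?thesis using pre by blast
qed

definition open_hemisphere :: "real^3 \<Rightarrow> (real^3) set" where
  "open_hemisphere a = {x \<in> unit_sphere. 0 < a \<bullet> x}"

lemma openin_open_hemisphere: "openin (top_of_set unit_sphere) (open_hemisphere a)"
proof -
  have "open_hemisphere a = unit_sphere \<inter> {x. 0 < a \<bullet> x}" by (auto simp: open_hemisphere_def)
  then show ?thesis by (simp add: open_halfspace_gt openin_open_Int)
qed

lemma uminus_open_hemisphere: "uminus ` open_hemisphere a = open_hemisphere (- a)"
proof -
  have "x \<in> uminus ` open_hemisphere a" if "x \<in> open_hemisphere (- a)" for x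
    using that by (intro image_eqI[of _ _ "- x"]) (auto simp: open_hemisphere_def)
  then show ?thesis by (auto simp: open_hemisphere_def)
qed

lemma veronese_open_hemisphere_minus:
  "veronese ` open_hemisphere (- a) = veronese ` open_hemisphere a"
  unfolding uminus_open_hemisphere[symmetric] image_image by simp

lemma homeomorphism_veronese_hemisphere:
  "\<exists>s. homeomorphism (open_hemisphere a) (veronese ` open_hemisphere a) veronese s"
proof (rule homeomorphism_injective_open_map)
  show "inj_on veronese (open_hemisphere a)"
  proof (rule inj_onI)
    fix x y assume xy: "x \<in> open_hemisphere a" "y \<in> open_hemisphere a" "veronese x = veronese y"
    then have "y = x \<or> y = - x" by (subst veronese_eq_iff[symmetric]) (auto simp: open_hemisphere_def)
    with xy show "x = y" by (auto simp: open_hemisphere_def)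
  qed
  fix U assume U: "openin (top_of_set (open_hemisphere a)) U"
  then have "openin (top_of_set unit_sphere) U"
    using openin_open_hemisphere openin_trans by blast
  then have "openin (top_of_set veronese_surface) (veronese ` U)"
    by (rule openin_veronese_image)
  moreover have "veronese ` open_hemisphere a \<subseteq> veronese_surface"
    by (auto simp: veronese_surface_def open_hemisphere_def)
  moreover have "veronese ` U \<subseteq> veronese ` open_hemisphere a"
    using U openin_imp_subset by blast
  ultimately show "openin (top_of_set (veronese ` open_hemisphere a)) (veronese ` U)"
    using openin_subset_trans by blast
qed (auto simp: continuous_on_veronese)

text \<open>The image of an open hemisphere is evenly covered by this hemisphere and its antipode.\<close>

lemma covering_space_veronese: "covering_space unit_sphere veronese veronese_surface"
  unfolding covering_space_def
proof (intro conjI ballI)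
  fix p assume "p \<in> veronese_surface"
  then obtain a where a: "norm a = 1" "p = veronese a" by (auto simp: veronese_surface_def)
  let ?U = "open_hemisphere a" and ?U' = "open_hemisphere (- a)"
  let ?T = "veronese ` ?U"
  have "a \<in> ?U" using a by (auto simp: open_hemisphere_def norm_eq_1)
  then have "p \<in> ?T" using a by blast
  moreover have "openin (top_of_set veronese_surface) ?T"
    by (intro openin_veronese_image openin_open_hemisphere)
  moreover have "\<Union>{?U, ?U'} = unit_sphere \<inter> veronese -` ?T"
  proof
    have "veronese x \<in> ?T" if "x \<in> ?U'" for x
      using that veronese_open_hemisphere_minus[of a] by blast
    then show "\<Union>{?U, ?U'} \<subseteq> unit_sphere \<inter> veronese -` ?T"
      by (auto simp: open_hemisphere_def)
    show "unit_sphere \<inter> veronese -` ?T \<subseteq> \<Union>{?U, ?U'}"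
    proof
      fix x assume "x \<in> unit_sphere \<inter> veronese -` ?T"
      then obtain u where "u \<in> ?U" "veronese u = veronese x" "norm x = 1" by auto
      then show "x \<in> \<Union>{?U, ?U'}"
        using veronese_eq_iff[of u x] by (auto simp: open_hemisphere_def)
    qed
  qed
  moreover have "pairwise disjnt {?U, ?U'}"
    by (auto simp: pairwise_insert disjnt_def open_hemisphere_def)
  moreover have "\<forall>u\<in>{?U, ?U'}. openin (top_of_set unit_sphere) u"
    by (simp add: openin_open_hemisphere)
  moreover have "\<forall>u\<in>{?U, ?U'}. \<exists>q. homeomorphism u ?T veronese q"
    using homeomorphism_veronese_hemisphere[of a] homeomorphism_veronese_hemisphere[of "- a"]
    by (simp add: veronese_open_hemisphere_minus)
  ultimately show "\<exists>T. p \<in> T \<and> openin (top_of_set veronese_surface) T \<and>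
        (\<exists>v. \<Union>v = unit_sphere \<inter> veronese -` T \<and>
             (\<forall>u\<in>v. openin (top_of_set unit_sphere) u) \<and>
             pairwise disjnt v \<and> (\<forall>u\<in>v. \<exists>q. homeomorphism u T veronese q))"
    by blast
qed (auto simp: continuous_on_veronese veronese_surface_def)

section \<open>Lifts to the sphere\<close>

text \<open>There is a continuous section of the covering over \<open>A\<close>.\<close>

definition lift_on :: "(real^3^3) set \<Rightarrow> bool" where
  "lift_on A \<longleftrightarrow> (\<exists>s. continuous_on A s \<and> s ` A \<subseteq> unit_sphere \<and> (\<forall>y\<in>A. veronese (s y) = y))"

text \<open>A section and its negative would split the sphere into two disjoint nonempty closed sets.\<close>

lemma no_global_lift: "\<not> lift_on veronese_surface"
proof
  assume "lift_on veronese_surface"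
  then obtain s where s: "continuous_on veronese_surface s" "s ` veronese_surface \<subseteq> unit_sphere"
    "\<And>y. y \<in> veronese_surface \<Longrightarrow> veronese (s y) = y"
    by (auto simp: lift_on_def)
  let ?A = "s ` veronese_surface" and ?B = "uminus ` s ` veronese_surface"
  have cpt: "compact veronese_surface"
    unfolding veronese_surface_def by (intro compact_continuous_image continuous_on_veronese) simp
  then have "compact ?A" using s compact_continuous_image by blast
  then have cl: "closed ?A" "closed ?B"
    by (auto simp: compact_imp_closed closed_negations)
  have sub: "?B \<subseteq> unit_sphere" using s(2) by auto
  have cov: "unit_sphere \<subseteq> ?A \<union> ?B"
  proof
    fix x :: "real^3" assume x: "x \<in> unit_sphere"
    then have v: "veronese x \<in> veronese_surface" by (auto simp: veronese_surface_def)
    then have "norm (s (veronese x)) = 1" using s(2) by auto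
    then have "s (veronese x) = x \<or> s (veronese x) = - x"
      using x s(3)[OF v] veronese_eq_iff[of x "s (veronese x)"] by auto
    then show "x \<in> ?A \<union> ?B" using v by (metis UnI1 UnI2 imageI minus_minus)
  qed
  have disj: "?A \<inter> ?B = {}"
  proof (rule ccontr)
    assume "?A \<inter> ?B \<noteq> {}"
    then obtain y z where yz: "y \<in> veronese_surface" "z \<in> veronese_surface" "s y = - s z" by blast
    then have "y = z" using s(3) by (metis veronese_minus)
    then have "- s y = s y" using yz(3) by simp
    then have "s y = 0" by (simp add: vec_eq_iff)
    moreover have "norm (s y) = 1" using s(2) yz(1) by auto
    ultimately show False by simp
  qed
  have "connected unit_sphere" by (intro connected_sphere) simp
  moreover have "veronese_surface \<noteq> {}" by (simp add: veronese_surface_def)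
  then have "?A \<inter> unit_sphere \<noteq> {}" "?B \<inter> unit_sphere \<noteq> {}"
    using s(2) sub by blast+
  ultimately show False
    using connected_closedD[of unit_sphere ?A ?B] cov disj cl by blast
qed

text \<open>On the intersection the two sections agree up to sign. Their inner product is \<open>1\<close> or \<open>- 1\<close> there,
hence constant by connectedness, so that one global sign makes them agree.\<close>

lemma lift_on_Un:
  assumes "lift_on A" "lift_on B" "closed A" "closed B" "connected (A \<inter> B)"
  shows "lift_on (A \<union> B)"
proof -
  obtain s where s: "continuous_on A s" "s ` A \<subseteq> unit_sphere" "\<And>y. y \<in> A \<Longrightarrow> veronese (s y) = y"
    using assms(1) by (auto simp: lift_on_def)
  obtain t where t: "continuous_on B t" "t ` B \<subseteq> unit_sphere" "\<And>y. y \<in> B \<Longrightarrow> veronese (t y) = y"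
    using assms(2) by (auto simp: lift_on_def)
  have pm: "s y = t y \<or> s y = - t y" if "y \<in> A \<inter> B" for y
    using that s(2,3) t(2,3) veronese_eq_iff[of "t y" "s y"] by force
  have inner: "s y \<bullet> t y = (if s y = t y then 1 else - 1)" if "y \<in> A \<inter> B" for y
    using pm[OF that] that t(2) by (force simp: norm_eq_1[symmetric] dot_square_norm)
  have "(\<lambda>y. s y \<bullet> t y) constant_on (A \<inter> B)"
  proof (rule continuous_finite_range_constant[OF assms(5)])
    show "continuous_on (A \<inter> B) (\<lambda>y. s y \<bullet> t y)"
      by (intro continuous_intros continuous_on_subset[OF s(1)] continuous_on_subset[OF t(1)]) auto
    show "finite ((\<lambda>y. s y \<bullet> t y) ` (A \<inter> B))"
      by (rule finite_subset[of _ "{1, - 1}"]) (auto simp: inner)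
  qed
  then obtain c where c: "\<And>y. y \<in> A \<inter> B \<Longrightarrow> s y \<bullet> t y = c"
    by (auto simp: constant_on_def)
  define \<epsilon> :: real where "\<epsilon> = (if c = 1 then 1 else - 1)"
  define u where "u y = (if y \<in> A then s y else \<epsilon> *\<^sub>R t y)" for y
  have agree: "s y = \<epsilon> *\<^sub>R t y" if "y \<in> A \<inter> B" for y
    using c[OF that] inner[OF that] pm[OF that] by (auto simp: \<epsilon>_def split: if_splits)
  have "continuous_on (A \<union> B) u"
    unfolding u_def
    by (intro continuous_on_cases assms s(1) continuous_intros t(1)) (use agree in auto)
  moreover have "u ` (A \<union> B) \<subseteq> unit_sphere"
    using s(2) t(2) by (auto simp: u_def \<epsilon>_def)
  moreover have "\<forall>y\<in>A \<union> B. veronese (u y) = y"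
    using s(3) t(3) by (auto simp: u_def \<epsilon>_def)
  ultimately show ?thesis unfolding lift_on_def by blast
qed

lemma lift_on_nullhomotopic:
  assumes "homotopic_with_canon (\<lambda>_. True) A veronese_surface id (\<lambda>_. p)"
  shows "lift_on A"
  using covering_space_lift_inessential_function[OF covering_space_veronese assms]
  unfolding lift_on_def by (metis id_apply)

section \<open>The body of a simplicial complex\<close>

abbreviation support :: "('a \<Rightarrow> real) \<Rightarrow> 'a set" where
  "support x \<equiv> {v. x v \<noteq> 0}"

text \<open>The geometric realization as a set of functions. Summing over the support instead of over all
vertices makes the definition compatible with unions and intersections of complexes.\<close>

definition body :: "'a set set \<Rightarrow> ('a \<Rightarrow> real) set" where
  "body K = {x. (\<forall>v. 0 \<le> x v) \<and> support x \<in> K \<and> sum x (support x) = 1}"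

lemma abstract_simplicial_complexD:
  assumes "abstract_simplicial_complex K"
  shows "finite K" "{} \<in> K" "\<sigma> \<in> K \<Longrightarrow> finite \<sigma>" "\<sigma> \<in> K \<Longrightarrow> \<tau> \<subseteq> \<sigma> \<Longrightarrow> \<tau> \<in> K"
  using assms unfolding abstract_simplicial_complex_def by blast+

lemma sum_support:
  assumes "finite \<sigma>" "support x \<subseteq> \<sigma>"
  shows "sum x (support x) = sum x \<sigma>"
  by (rule sum.mono_neutral_left) (use assms in auto)

lemma geometric_realization_eq_body:
  assumes K: "abstract_simplicial_complex K"
  shows "geometric_realization K = top_of_set (body K)"
proof -
  have fin: "finite (vertices K)"
    using abstract_simplicial_complexD[OF K] by (auto simp: vertices_def)
  have "{x. (\<forall>v. 0 \<le> x v) \<and> support x \<in> K \<and> sum x (vertices K) = 1} = body K"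
    unfolding body_def
  proof (rule Collect_cong)
    fix x :: "'a \<Rightarrow> real"
    have "sum x (support x) = sum x (vertices K)" if "support x \<in> K"
      using that by (intro sum_support fin) (auto simp: vertices_def)
    then show "(\<forall>v. 0 \<le> x v) \<and> support x \<in> K \<and> sum x (vertices K) = 1 \<longleftrightarrow>
        (\<forall>v. 0 \<le> x v) \<and> support x \<in> K \<and> sum x (support x) = 1" by metis
  qed
  then show ?thesis
    by (simp add: geometric_realization_def euclidean_product_topology)
qed

lemma body_mono: "K \<subseteq> L \<Longrightarrow> body K \<subseteq> body L"
  by (auto simp: body_def)

lemma body_Un: "body (K \<union> L) = body K \<union> body L"
  by (auto simp: body_def)

lemma body_Int: "body (K \<inter> L) = body K \<inter> body L"
  by (auto simp: body_def)

lemma body_nonneg: "x \<in> body K \<Longrightarrow> 0 \<le> x v"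
  by (simp add: body_def)

lemma body_sum:
  assumes "x \<in> body K" "finite \<sigma>" "\<And>v. v \<notin> \<sigma> \<Longrightarrow> x v = 0"
  shows "sum x \<sigma> = 1"
  using assms sum_support[of \<sigma> x] by (auto simp: body_def)

lemma bodyI:
  assumes "abstract_simplicial_complex K" "\<And>v. 0 \<le> x v" "\<sigma> \<in> K" "\<And>v. v \<notin> \<sigma> \<Longrightarrow> x v = 0"
    "sum x \<sigma> = 1"
  shows "x \<in> body K"
proof -
  have "support x \<subseteq> \<sigma>" using assms(4) by auto
  then show ?thesis
    using assms abstract_simplicial_complexD[OF assms(1)] sum_support[of \<sigma> x]
    by (auto simp: body_def)
qed

lemma support_nonempty: "x \<in> body K \<Longrightarrow> support x \<noteq> {}"
  by (metis (mono_tags, lifting) body_def mem_Collect_eq sum.empty zero_neq_one)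

definition vertex_point :: "'a \<Rightarrow> 'a \<Rightarrow> real" where
  "vertex_point a = (\<lambda>v. if v = a then 1 else 0)"

lemma vertex_point_in_body:
  assumes "abstract_simplicial_complex K" "{a} \<in> K"
  shows "vertex_point a \<in> body K"
  by (rule bodyI[OF assms(1) _ assms(2)]) (auto simp: vertex_point_def)

definition segment_point :: "real \<Rightarrow> ('a \<Rightarrow> real) \<Rightarrow> ('a \<Rightarrow> real) \<Rightarrow> 'a \<Rightarrow> real" where
  "segment_point t x y = (\<lambda>v. (1 - t) * x v + t * y v)"

lemma segment_point_in_body:
  assumes K: "abstract_simplicial_complex K" and x: "x \<in> body K" and y: "y \<in> body K"
    and un: "support x \<union> support y \<in> K" and t: "t \<in> {0..1}"
  shows "segment_point t x y \<in> body K"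
proof (rule bodyI[OF K _ un])
  let ?\<sigma> = "support x \<union> support y"
  have fin: "finite ?\<sigma>" using abstract_simplicial_complexD[OF K] un by blast
  have "sum x ?\<sigma> = 1" "sum y ?\<sigma> = 1"
    by (rule body_sum[OF x fin] body_sum[OF y fin]; simp)+
  then show "sum (segment_point t x y) ?\<sigma> = 1"
    unfolding segment_point_def sum.distrib sum_distrib_left[symmetric] by simp
  show "0 \<le> segment_point t x y v" for v
    using t body_nonneg[OF x] body_nonneg[OF y] by (auto simp: segment_point_def)
qed (auto simp: segment_point_def)

lemma open_positive_coordinates:
  assumes "finite \<sigma>"
  shows "open {x :: 'a \<Rightarrow> real. \<forall>v\<in>\<sigma>. 0 < x v}"
proof -
  have "{x :: 'a \<Rightarrow> real. \<forall>v\<in>\<sigma>. 0 < x v} = (\<Inter>v\<in>\<sigma>. {x. 0 < x v})" by auto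
  moreover have "open {x :: 'a \<Rightarrow> real. 0 < x v}" for v
    by (intro open_Collect_less continuous_on_const continuous_on_product_coordinates)
  ultimately show ?thesis using assms by (simp add: open_INT)
qed

text \<open>The complement is the union of the open stars of the faces outside of the subcomplex.\<close>

lemma closedin_body_subcomplex:
  assumes L: "abstract_simplicial_complex L" and K: "abstract_simplicial_complex K" and "K \<subseteq> L"
  shows "closedin (top_of_set (body L)) (body K)"
proof -
  let ?G = "\<Union>\<sigma>\<in>L - K. {x :: 'a \<Rightarrow> real. \<forall>v\<in>\<sigma>. 0 < x v}"
  have "open ?G"
    using abstract_simplicial_complexD[OF L] by (intro open_UN ballI open_positive_coordinates) blast
  moreover have "body L - body K = body L \<inter> ?G"
  proof
    show "body L - body K \<subseteq> body L \<inter> ?G"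
    proof
      fix x assume x: "x \<in> body L - body K"
      then have "support x \<in> L - K" by (auto simp: body_def)
      moreover have "\<forall>v\<in>support x. 0 < x v"
        using x body_nonneg[of x L] by (auto simp: order_less_le)
      ultimately show "x \<in> body L \<inter> ?G" using x by blast
    qed
    show "body L \<inter> ?G \<subseteq> body L - body K"
    proof
      fix x assume "x \<in> body L \<inter> ?G"
      then obtain \<sigma> where \<sigma>: "x \<in> body L" "\<sigma> \<in> L - K" "\<forall>v\<in>\<sigma>. 0 < x v" by blast
      then have "\<sigma> \<subseteq> support x" by force
      then have "support x \<notin> K" using abstract_simplicial_complexD(4)[OF K] \<sigma>(2) by blast
      then show "x \<in> body L - body K" using \<sigma>(1) by (simp add: body_def)
    qed
  qed
  ultimately show ?thesis
    using body_mono[OF \<open>K \<subseteq> L\<close>]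
    by (simp add: closedin_def openin_open_Int)
qed

text \<open>Every point is joined by a segment to a vertex of its carrier, and edges join the vertices.\<close>

lemma connected_body:
  assumes K: "abstract_simplicial_complex K"
    and path: "\<And>u v. {u} \<in> K \<Longrightarrow> {v} \<in> K \<Longrightarrow> (u, v) \<in> {(u, v). {u, v} \<in> K}\<^sup>*"
  shows "connected (body K)"
proof -
  have seg: "connected_component (body K) x y"
    if x: "x \<in> body K" and y: "y \<in> body K" and un: "support x \<union> support y \<in> K" for x y
  proof -
    have "connected ((\<lambda>t. segment_point t x y) ` {0..1})"
      unfolding segment_point_def
      by (intro connected_continuous_image continuous_intros) auto
    moreover have "(\<lambda>t. segment_point t x y) ` {0..1} \<subseteq> body K"
      using segment_point_in_body[OF K x y un] by blast
    moreover have "x \<in> (\<lambda>t. segment_point t x y) ` {0..1}"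
      by (rule image_eqI[of _ _ 0]) (auto simp: segment_point_def)
    moreover have "y \<in> (\<lambda>t. segment_point t x y) ` {0..1}"
      by (rule image_eqI[of _ _ 1]) (auto simp: segment_point_def)
    ultimately show ?thesis
      unfolding connected_component_def by blast
  qed
  have supp: "support (vertex_point u) = {u}" for u :: 'a
    by (auto simp: vertex_point_def)
  have face: "{u} \<in> K" if "u \<in> \<sigma>" "\<sigma> \<in> K" for u \<sigma>
    using abstract_simplicial_complexD(4)[OF K that(2), of "{u}"] that(1) by simp
  have vv: "connected_component (body K) (vertex_point u) (vertex_point v)"
    if "(u, v) \<in> {(u, v). {u, v} \<in> K}\<^sup>*" "{u} \<in> K" for u v
    using that
  proof (induction rule: rtrancl_induct)
    case base
    then show ?case using vertex_point_in_body[OF K] by (simp add: connected_component_refl)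
  next
    case (step v w)
    then have "{v, w} \<in> K" by simp
    moreover have "{v} \<in> K" "{w} \<in> K" using face[of _ "{v, w}"] \<open>{v, w} \<in> K\<close> by auto
    moreover have "support (vertex_point v) \<union> support (vertex_point w) = {v, w}"
      unfolding supp by auto
    ultimately have "connected_component (body K) (vertex_point v) (vertex_point w)"
      using seg vertex_point_in_body[OF K] by metis
    then show ?case using step connected_component_trans by blast
  qed
  have xv: "\<exists>u. {u} \<in> K \<and> connected_component (body K) x (vertex_point u)" if x: "x \<in> body K" for x
  proof -
    obtain u where u: "u \<in> support x" using support_nonempty[OF x] by blast
    have sx: "support x \<in> K" using x by (simp add: body_def)
    have "{u} \<in> K" using face[OF u sx] .
    moreover have "support x \<union> support (vertex_point u) \<in> K"
      using u sx by (simp add: supp insert_absorb)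
    ultimately show ?thesis using seg[OF x] vertex_point_in_body[OF K] by blast
  qed
  show ?thesis
    unfolding connected_iff_connected_component
  proof (intro ballI)
    fix x y assume "x \<in> body K" "y \<in> body K"
    then obtain u v where u: "{u} \<in> K" "connected_component (body K) x (vertex_point u)"
      and v: "{v} \<in> K" "connected_component (body K) y (vertex_point v)"
      using xv by blast
    have "connected_component (body K) (vertex_point u) (vertex_point v)"
      by (rule vv[OF path[OF u(1) v(1)] u(1)])
    then show "connected_component (body K) x y"
      using u(2) connected_component_sym[OF v(2)] connected_component_trans by metis
  qed
qed

section \<open>Lifts over closed stars\<close>

definition closed_star :: "'a set set \<Rightarrow> 'a \<Rightarrow> 'a set set" where
  "closed_star K a = {\<sigma>. insert a \<sigma> \<in> K}"

lemma closed_star_subset: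
  assumes "abstract_simplicial_complex K"
  shows "closed_star K a \<subseteq> K"
proof
  fix \<sigma> assume "\<sigma> \<in> closed_star K a"
  then have "insert a \<sigma> \<in> K" by (simp add: closed_star_def)
  then show "\<sigma> \<in> K" by (rule abstract_simplicial_complexD(4)[OF assms]) blast
qed

lemma abstract_simplicial_complex_closed_star:
  assumes K: "abstract_simplicial_complex K" and a: "{a} \<in> K"
  shows "abstract_simplicial_complex (closed_star K a)"
proof -
  note sub = closed_star_subset[OF K, of a]
  have "finite (closed_star K a)" "\<forall>\<sigma>\<in>closed_star K a. finite \<sigma>"
    using sub abstract_simplicial_complexD(1,3)[OF K] finite_subset by blast+
  moreover have "\<tau> \<in> closed_star K a" if "\<sigma> \<in> closed_star K a" "\<tau> \<subseteq> \<sigma>" for \<sigma> \<tau>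
    using that abstract_simplicial_complexD(4)[OF K, of "insert a \<sigma>" "insert a \<tau>"]
    unfolding closed_star_def by blast
  moreover have "{} \<in> closed_star K a" using a by (simp add: closed_star_def)
  ultimately show ?thesis unfolding abstract_simplicial_complex_def by blast
qed

lemma abstract_simplicial_complex_Int:
  assumes "abstract_simplicial_complex K" "abstract_simplicial_complex L"
  shows "abstract_simplicial_complex (K \<inter> L)"
  using assms unfolding abstract_simplicial_complex_def by (auto 0 3)

text \<open>The closed star is a cone with apex \<open>a\<close>, so its inclusion is homotopic to a constant map, and
the homotopy lifts through the covering.\<close>

lemma lift_on_closed_star:
  assumes K: "abstract_simplicial_complex K" and a: "{a} \<in> K"
    and hom: "homeomorphism (body K) veronese_surface h g"
  shows "lift_on (h ` body (closed_star K a))"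
proof (rule lift_on_nullhomotopic)
  let ?S = "closed_star K a"
  let ?A = "h ` body ?S"
  have S: "abstract_simplicial_complex ?S"
    using K a by (rule abstract_simplicial_complex_closed_star)
  have SK: "body ?S \<subseteq> body K"
    by (intro body_mono closed_star_subset K)
  have A: "?A \<subseteq> veronese_surface"
    using hom SK by (auto simp: homeomorphism_def)
  have gA: "g y \<in> body ?S" if "y \<in> ?A" for y
    using that hom SK by (auto simp: homeomorphism_def subset_iff)
  have cone: "segment_point t x (vertex_point a) \<in> body ?S" if "x \<in> body ?S" "t \<in> {0..1}" for x t
  proof (rule segment_point_in_body[OF S that(1) _ _ that(2)])
    show "vertex_point a \<in> body ?S"
      using vertex_point_in_body[OF S] a by (simp add: closed_star_def)
    show "support x \<union> support (vertex_point a) \<in> ?S"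
    proof -
      have "support (vertex_point a) = {a}" by (auto simp: vertex_point_def)
      moreover have "insert a (support x) \<in> K" using that(1) by (simp add: body_def closed_star_def)
      ultimately show ?thesis by (simp add: closed_star_def)
    qed
  qed
  define H where "H = (\<lambda>(t, y). h (segment_point t (g y) (vertex_point a)))"
  have seg: "continuous_on ({0..1} \<times> ?A) (\<lambda>z. segment_point (fst z) (g (snd z)) (vertex_point a))"
    unfolding segment_point_def
  proof (intro continuous_on_coordinatewise_then_product continuous_intros)
    fix v
    have "continuous_on ?A g"
      using hom A by (auto simp: homeomorphism_def intro: continuous_on_subset)
    then have "continuous_on ?A (\<lambda>y. g y v)"
      by (rule continuous_on_product_then_coordinatewise)
    then show "continuous_on ({0..1} \<times> ?A) (\<lambda>z. g (snd z) v)"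
      by (rule continuous_on_compose2) (auto intro: continuous_intros)
  qed
  have in_body: "segment_point (fst z) (g (snd z)) (vertex_point a) \<in> body ?S"
    if "z \<in> {0..1} \<times> ?A" for z
  proof (rule cone)
    show "g (snd z) \<in> body ?S" using that by (intro gA) auto
  qed (use that in auto)
  have "continuous_on (body ?S) h"
    using hom SK by (auto simp: homeomorphism_def intro: continuous_on_subset)
  then have "continuous_on ({0..1} \<times> ?A) (\<lambda>z. h (segment_point (fst z) (g (snd z)) (vertex_point a)))"
    using seg
  proof (rule continuous_on_compose2)
    show "(\<lambda>z. segment_point (fst z) (g (snd z)) (vertex_point a)) ` ({0..1} \<times> ?A) \<subseteq> body ?S"
      by (rule image_subsetI) (rule in_body)
  qed
  then have "continuous_on ({0..1} \<times> ?A) H"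
    unfolding H_def case_prod_unfold .
  moreover have "H z \<in> veronese_surface" if "z \<in> {0..1} \<times> ?A" for z
    using A in_body[OF that] unfolding H_def case_prod_unfold by blast
  ultimately have H: "continuous_map (prod_topology (top_of_set {0..1}) (top_of_set ?A))
      (top_of_set veronese_surface) H"
    by (simp add: prod_topology_subtopology_eu Pi_iff)
  have H0: "H (0, y) = y" if "y \<in> ?A" for y
  proof -
    have "h (g y) = y" using that A hom by (auto simp: homeomorphism_def)
    then show ?thesis by (simp add: H_def segment_point_def)
  qed
  have H1: "H (1, y) = h (vertex_point a)" for y
    by (simp add: H_def segment_point_def)
  show "homotopic_with_canon (\<lambda>_. True) ?A veronese_surface id (\<lambda>_. h (vertex_point a))"
  proof (subst homotopic_with)
    show "\<exists>k. continuous_map (prod_topology (top_of_set {0..1::real}) (top_of_set ?A))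
            (top_of_set veronese_surface) k \<and>
          (\<forall>x\<in>topspace (top_of_set ?A). k (0, x) = id x) \<and>
          (\<forall>x\<in>topspace (top_of_set ?A). k (1, x) = h (vertex_point a)) \<and>
          (\<forall>t\<in>{0..1::real}. True)"
      by (rule exI[of _ H]) (use H H0 H1 in auto)
  qed simp
qed

section \<open>Local structure of triangulated surfaces\<close>

text \<open>The covering is injective on an open hemisphere, and stereographic projection from the point
opposite to its centre is a planar chart there.\<close>

lemma veronese_surface_locally_euclidean:
  assumes "p \<in> veronese_surface"
  obtains N W \<phi> \<psi> where "openin (top_of_set veronese_surface) N" "p \<in> N" "open W"
    "homeomorphism N (W :: (real \<times> real) set) \<phi> \<psi>"
proof -
  obtain a where a: "norm a = 1" "p = veronese a"
    using assms by (auto simp: veronese_surface_def)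
  let ?U = "open_hemisphere a"
  let ?N = "veronese ` ?U"
  have aU: "a \<in> ?U" using a by (auto simp: open_hemisphere_def norm_eq_1)
  obtain s where s: "homeomorphism ?U ?N veronese s"
    using homeomorphism_veronese_hemisphere by blast
  have "(unit_sphere - {- a}) homeomorphic (UNIV :: (real \<times> real) set)"
    by (rule homeomorphic_punctured_sphere_affine) (use a in auto)
  then obtain f g where fg: "homeomorphism (unit_sphere - {- a}) (UNIV :: (real \<times> real) set) f g"
    by (auto simp: homeomorphic_def)
  have sub: "?U \<subseteq> unit_sphere - {- a}"
    using a by (auto simp: open_hemisphere_def norm_eq_1)
  have "openin (top_of_set (unit_sphere - {- a})) ?U"
    using openin_open_hemisphere sub by (meson Diff_subset openin_subset_trans)
  then have "open (f ` ?U)"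
    using homeomorphism_imp_open_map[OF fg] by auto
  moreover have "homeomorphism ?U (f ` ?U) f g"
    using fg sub homeomorphism_of_subsets by blast
  ultimately have "homeomorphism ?N (f ` ?U) (f \<circ> s) (veronese \<circ> g)"
    using homeomorphism_compose homeomorphism_sym s by blast
  moreover have "openin (top_of_set veronese_surface) ?N"
    by (intro openin_veronese_image openin_open_hemisphere)
  ultimately show thesis
    using that \<open>open (f ` ?U)\<close> aU a by blast
qed

definition locally_planar :: "'a::topological_space set \<Rightarrow> bool" where
  "locally_planar X \<longleftrightarrow> (\<forall>x\<in>X. \<exists>N W \<phi> \<psi>. openin (top_of_set X) N \<and> x \<in> N \<and>
     open (W :: (real \<times> real) set) \<and> homeomorphism N W \<phi> \<psi>)"

lemma locally_planar_homeomorphism: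
  assumes "homeomorphism X veronese_surface h g"
  shows "locally_planar X"
  unfolding locally_planar_def
proof
  fix x assume x: "x \<in> X"
  have gh: "homeomorphism veronese_surface X g h" using assms homeomorphism_sym by blast
  have "h x \<in> veronese_surface" using x assms by (auto simp: homeomorphism_def)
  then obtain N W \<phi> \<psi> where N: "openin (top_of_set veronese_surface) N" "h x \<in> N"
    "open W" "homeomorphism N (W :: (real \<times> real) set) \<phi> \<psi>"
    by (rule veronese_surface_locally_euclidean)
  have "N \<subseteq> veronese_surface" using N openin_imp_subset by blast
  then have "homeomorphism N (g ` N) g h"
    by (rule homeomorphism_of_subsets[OF gh _ order_refl refl])
  then have "homeomorphism (g ` N) N h g" by (rule homeomorphism_symD)
  then have "homeomorphism (g ` N) W (\<phi> \<circ> h) (g \<circ> \<psi>)"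
    using N(4) by (rule homeomorphism_compose)
  moreover have "openin (top_of_set X) (g ` N)"
    using gh N(1) by (rule homeomorphism_imp_open_map)
  moreover have "x \<in> g ` N"
    using x assms N(2) by (metis homeomorphism_apply1 imageI)
  ultimately show "\<exists>N W \<phi> \<psi>. openin (top_of_set X) N \<and> x \<in> N \<and>
     open (W :: (real \<times> real) set) \<and> homeomorphism N W \<phi> \<psi>"
    using N(3) by blast
qed

text \<open>Invariance of domain, transported by charts.\<close>

lemma locally_planar_open_image:
  assumes X: "locally_planar X" and U: "openin (top_of_set X) U"
    and f: "continuous_on U f" "inj_on f U"
  shows "open (f ` U :: (real \<times> real) set)"
proof (subst open_subopen, intro ballI)
  fix y assume "y \<in> f ` U"
  then obtain x where x: "x \<in> U" "y = f x" by blast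
  then have "x \<in> X" using U openin_imp_subset by blast
  then obtain N W \<phi> \<psi> where N: "openin (top_of_set X) N" "x \<in> N"
     "open (W :: (real \<times> real) set)" "homeomorphism N W \<phi> \<psi>"
    using X unfolding locally_planar_def by blast
  have "openin (top_of_set N) (N \<inter> U)"
    using U N(1) by (metis Int_commute Int_lower1 openin_Int openin_imp_subset openin_subset_trans)
  then have op: "open (\<phi> ` (N \<inter> U))"
    using N(3,4) homeomorphism_imp_open_map openin_open_eq by blast
  have hom: "homeomorphism (\<phi> ` (N \<inter> U)) (N \<inter> U) \<psi> \<phi>"
    using N(4) by (meson Int_lower1 homeomorphism_of_subsets homeomorphism_sym)
  have "open ((f \<circ> \<psi>) ` (\<phi> ` (N \<inter> U)))"
  proof (rule invariance_of_domain[OF _ op])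
    show "continuous_on (\<phi> ` (N \<inter> U)) (f \<circ> \<psi>)"
      using hom f(1) by (intro continuous_on_compose) (auto simp: homeomorphism_def intro: continuous_on_subset)
    show "inj_on (f \<circ> \<psi>) (\<phi> ` (N \<inter> U))"
      using hom f(2) by (intro comp_inj_on inj_on_inverseI[of _ \<phi>])
        (auto simp: homeomorphism_def intro: inj_on_subset)
  qed
  also have "(f \<circ> \<psi>) ` (\<phi> ` (N \<inter> U)) = f ` (N \<inter> U)"
    using hom by (metis homeomorphism_image1 image_comp)
  finally show "\<exists>T. open T \<and> y \<in> T \<and> T \<subseteq> f ` U"
    using x N(2) by blast
qed

text \<open>Invariance of domain once more, now for maps from the plane into \<open>X\<close>.\<close>

lemma openin_embedded_disc:
  assumes X: "locally_planar X" and D: "open (D :: (real \<times> real) set)"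
    and f: "continuous_on D f" "inj_on f D" "f ` D \<subseteq> X"
  shows "openin (top_of_set X) (f ` D)"
proof (subst openin_subopen, intro ballI)
  fix y assume "y \<in> f ` D"
  then obtain d where d: "d \<in> D" "y = f d" by blast
  then obtain N W \<phi> \<psi> where N: "openin (top_of_set X) N" "y \<in> N"
     "open (W :: (real \<times> real) set)" "homeomorphism N W \<phi> \<psi>"
  proof -
    have "y \<in> X" using d f(3) by auto
    then show thesis using X that unfolding locally_planar_def by metis
  qed
  define E where "E = D \<inter> f -` N"
  have "openin (top_of_set D) E"
    unfolding E_def using f(1,3) N(1) by (intro continuous_openin_preimage[of D f X]) auto
  then have E: "open E" using D openin_open_eq by blast
  have fE: "f ` E \<subseteq> N" by (auto simp: E_def)
  have op: "open ((\<phi> \<circ> f) ` E)"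
  proof (rule invariance_of_domain[OF _ E])
    have "continuous_on N \<phi>" "inj_on \<phi> N"
      using N(4) by (auto simp: homeomorphism_def intro: inj_on_inverseI[of _ \<psi>])
    then have "continuous_on (f ` E) \<phi>" "inj_on \<phi> (f ` E)"
      using fE continuous_on_subset inj_on_subset by blast+
    moreover have "continuous_on E f" "inj_on f E"
      using f(1,2) by (auto simp: E_def intro: continuous_on_subset inj_on_subset)
    ultimately show "continuous_on E (\<phi> \<circ> f)" "inj_on (\<phi> \<circ> f) E"
      using continuous_on_compose comp_inj_on by blast+
  qed
  have "(\<phi> \<circ> f) ` E \<subseteq> W" using fE N(4) by (auto simp: homeomorphism_def)
  then have "openin (top_of_set W) ((\<phi> \<circ> f) ` E)" using op N(3) by (simp add: openin_open_eq)
  then have "openin (top_of_set N) (\<psi> ` (\<phi> \<circ> f) ` E)"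
    using N(4) homeomorphism_imp_open_map homeomorphism_sym by blast
  also have "\<psi> ` (\<phi> \<circ> f) ` E = f ` E"
  proof -
    have "\<psi> (\<phi> (f x)) = f x" if "x \<in> E" for x
      using that fE N(4) by (auto simp: homeomorphism_def)
    then show ?thesis by (simp add: image_image)
  qed
  finally have "openin (top_of_set X) (f ` E)" using N(1) openin_trans by blast
  moreover have "y \<in> f ` E" "f ` E \<subseteq> f ` D" using d N(2) by (auto simp: E_def)
  ultimately show "\<exists>T. openin (top_of_set X) T \<and> y \<in> T \<and> T \<subseteq> f ` D" by blast
qed

lemma openin_open_star:
  assumes "finite \<sigma>"
  shows "openin (top_of_set (body K)) {x \<in> body K. \<forall>v\<in>\<sigma>. 0 < x v}"
proof -
  have "{x \<in> body K. \<forall>v\<in>\<sigma>. 0 < x v} = body K \<inter> {x. \<forall>v\<in>\<sigma>. 0 < x v}" by auto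
  then show ?thesis using open_positive_coordinates[OF assms] by (simp add: openin_open_Int)
qed

text \<open>The open star of an isolated vertex would be an open point, but a chart has no isolated points.\<close>

lemma vertex_in_edge:
  assumes K: "abstract_simplicial_complex K" and X: "locally_planar (body K)" and u: "{u} \<in> K"
  shows "\<exists>v. v \<noteq> u \<and> {u, v} \<in> K"
proof (rule ccontr)
  assume no: "\<not> ?thesis"
  let ?O = "{x \<in> body K. \<forall>v\<in>{u}. 0 < x v}"
  have "x = vertex_point u" if x: "x \<in> ?O" for x
  proof -
    have z: "x v = 0" if "v \<noteq> u" for v
    proof (rule ccontr)
      assume "x v \<noteq> 0"
      then have "{u, v} \<subseteq> support x" using x by auto
      moreover have "support x \<in> K" using x by (simp add: body_def)
      ultimately show False
        using no that abstract_simplicial_complexD(4)[OF K] by blast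
    qed
    then have "sum x {u} = 1" using x by (intro body_sum) auto
    with z show ?thesis by (auto simp: vertex_point_def)
  qed
  moreover have "vertex_point u \<in> ?O"
    using vertex_point_in_body[OF K u] by (simp add: vertex_point_def)
  ultimately have "?O = {vertex_point u}" by blast
  then have "openin (top_of_set (body K)) {vertex_point u}"
    using openin_open_star[of "{u}" K] by simp
  then have "open ((\<lambda>_. (0, 0)) ` {vertex_point u} :: (real \<times> real) set)"
    by (intro locally_planar_open_image[OF X]) auto
  then show False using not_open_singleton by fastforce
qed

text \<open>The vertices opposite to \<open>e\<close> in the faces that extend \<open>e\<close> by one vertex; for an edge of a
2-dimensional complex, these correspond to the triangles that contain it.\<close>

definition apexes :: "'a set set \<Rightarrow> 'a set \<Rightarrow> 'a set" where
  "apexes K e = {w. w \<notin> e \<and> insert w e \<in> K}"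

lemma finite_apexes:
  assumes "abstract_simplicial_complex K"
  shows "finite (apexes K e)"
proof (rule finite_subset)
  show "apexes K e \<subseteq> \<Union>K" by (auto simp: apexes_def)
  show "finite (\<Union>K)" using abstract_simplicial_complexD[OF assms] by blast
qed

text \<open>Around an edge with at most one triangle the realization is a half-plane or a line: the map \<open>f\<close>
below is injective there and takes no values with negative second coordinate, but it takes the
value \<open>(1/2, 0)\<close>, so that its image is not open.\<close>

lemma edge_has_two_apexes:
  assumes K: "abstract_simplicial_complex K" and X: "locally_planar (body K)"
    and uv: "u \<noteq> v" "{u, v} \<in> K"
  shows "2 \<le> card (apexes K {u, v})"
proof (rule ccontr)
  assume "\<not> ?thesis"
  then have "card (apexes K {u, v}) \<le> 1" by simp
  then have one: "w = w'" if "w \<in> apexes K {u, v}" "w' \<in> apexes K {u, v}" for w w'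
    using that finite_apexes[OF K, of "{u, v}"] by (metis One_nat_def card_le_Suc0_iff_eq)
  let ?O = "{x \<in> body K. \<forall>z\<in>{u, v}. 0 < x z}"
  \<comment> \<open>The second component is the coordinate of the only possible apex.\<close>
  define f :: "('a \<Rightarrow> real) \<Rightarrow> real \<times> real" where "f x = (x u, 1 - x u - x v)" for x
  have apex: "z \<in> apexes K {u, v}" if "x \<in> ?O" "z \<notin> {u, v}" "x z \<noteq> 0" for x z
  proof -
    have "insert z {u, v} \<subseteq> support x" using that by auto
    moreover have "support x \<in> K" using that by (simp add: body_def)
    ultimately show ?thesis
      using that(2) abstract_simplicial_complexD(4)[OF K] by (auto simp: apexes_def)
  qed
  have snd: "1 - x u - x v = (if z \<in> apexes K {u, v} then x z else 0)"
    if x: "x \<in> ?O" and z: "z \<in> apexes K {u, v} \<or> apexes K {u, v} = {}" for x z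
  proof (cases "z \<in> apexes K {u, v}")
    case True
    then have "sum x {u, v, z} = 1"
      using x apex[OF x] one by (intro body_sum) blast+
    moreover have "z \<noteq> u" "z \<noteq> v" using True by (auto simp: apexes_def)
    ultimately show ?thesis using uv(1) True by simp
  next
    case False
    then have "sum x {u, v} = 1"
      using x apex[OF x] z by (intro body_sum) blast+
    then show ?thesis using uv(1) False by simp
  qed
  have "inj_on f ?O"
  proof (rule inj_onI)
    fix x y assume x: "x \<in> ?O" and y: "y \<in> ?O" and eq: "f x = f y"
    show "x = y"
    proof
      fix z
      show "x z = y z"
      proof (cases "z \<in> apexes K {u, v}")
        case True
        then show ?thesis using snd[OF x, of z] snd[OF y, of z] eq by (simp add: f_def)
      next
        case False
        then have "x z = 0 \<and> y z = 0" if "z \<notin> {u, v}"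
          using apex[OF x that] apex[OF y that] by blast
        then show ?thesis using eq by (cases "z \<in> {u, v}") (auto simp: f_def)
      qed
    qed
  qed
  moreover have "continuous_on ?O f"
    unfolding f_def
    by (intro continuous_intros continuous_on_subset[OF continuous_on_product_coordinates]) auto
  ultimately have op: "open (f ` ?O)"
    by (intro locally_planar_open_image[OF X] openin_open_star) auto
  define m where "m = (\<lambda>z. if z \<in> {u, v} then 1/2 else 0 :: real)"
  have "m \<in> body K"
    by (rule bodyI[OF K _ uv(2)]) (use uv(1) in \<open>auto simp: m_def\<close>)
  then have "f m \<in> f ` ?O" by (auto simp: m_def)
  moreover have "f m = (1/2, 0)" by (simp add: f_def m_def)
  ultimately have "(1/2, 0) \<in> f ` ?O" by simp
  from openE[OF op this] obtain e where e: "0 < e" "ball (1/2, 0) e \<subseteq> f ` ?O" .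
  have "(1/2, - e/2) \<in> ball (1/2, 0 :: real) e"
    using e(1) by (simp add: dist_Pair_Pair dist_real_def)
  then obtain x where x: "x \<in> ?O" "f x = (1/2, - e/2)" using e(2) by force
  have "0 \<le> 1 - x u - x v"
  proof (cases "apexes K {u, v} = {}")
    case True then show ?thesis using snd[OF x(1)] by simp
  next
    case False
    then obtain z where "z \<in> apexes K {u, v}" by blast
    then show ?thesis using snd[OF x(1), of z] x(1) body_nonneg[of x K z] by auto
  qed
  then show False using x(2) e(1) by (simp add: f_def)
qed

text \<open>If there are three triangles at an edge, two of them contain a planar disc around the midpoint of
the edge. The disc is open in the realization by invariance of domain, but points of the third
triangle come arbitrarily close to the midpoint.\<close>

lemma edge_has_at_most_two_apexes:
  assumes K: "abstract_simplicial_complex K" and X: "locally_planar (body K)"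
    and uv: "u \<noteq> v"
  shows "card (apexes K {u, v}) \<le> 2"
proof (rule ccontr)
  assume "\<not> ?thesis"
  then obtain T where "T \<subseteq> apexes K {u, v}" "card T = 3"
    by (metis not_less_eq_eq numeral_2_eq_2 numeral_3_eq_3 obtain_subset_with_card_n)
  then obtain p q r where pqr: "p \<in> apexes K {u, v}" "q \<in> apexes K {u, v}" "r \<in> apexes K {u, v}"
    "p \<noteq> q" "p \<noteq> r" "q \<noteq> r"
    by (auto simp: card_3_iff)
  then have ne: "p \<noteq> u" "p \<noteq> v" "q \<noteq> u" "q \<noteq> v" "r \<noteq> u" "r \<noteq> v"
    by (auto simp: apexes_def)
  define D where "D = ball (0 :: real) (1/4) \<times> ball (0 :: real) (1/2)"
  \<comment> \<open>The first coordinate moves along the edge, the second one into the triangle of \<open>p\<close> or of \<open>q\<close>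
    according to its sign.\<close>
  define f :: "real \<times> real \<Rightarrow> 'a \<Rightarrow> real" where
    "f = (\<lambda>(s, t) z. if z = u then 1/2 + s - \<bar>t\<bar>/2 else if z = v then 1/2 - s - \<bar>t\<bar>/2
       else if z = p then max t 0 else if z = q then max (- t) 0 else 0)"
  have D: "open D" unfolding D_def by (intro open_Times) auto
  have "f d \<in> body K" if "d \<in> D" for d
  proof -
    obtain s t where d: "d = (s, t)" by force
    have st: "\<bar>s\<bar> < 1/4" "\<bar>t\<bar> < 1/2" using that d by (auto simp: D_def)
    show ?thesis
    proof (cases "0 \<le> t")
      case True
      show ?thesis
      proof (rule bodyI[OF K])
        show "{p, u, v} \<in> K" using pqr(1) by (simp add: apexes_def)
      qed (use True st d ne pqr(4) uv in \<open>auto simp: f_def\<close>)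
    next
      case False
      show ?thesis
      proof (rule bodyI[OF K])
        show "{q, u, v} \<in> K" using pqr(2) by (simp add: apexes_def)
      qed (use False st d ne pqr(4) uv in \<open>auto simp: f_def\<close>)
    qed
  qed
  then have sub: "f ` D \<subseteq> body K" by blast
  have inj: "inj_on f D"
  proof (rule inj_onI)
    fix d d' assume eq: "f d = f d'"
    obtain s t s' t' where d: "d = (s, t)" "d' = (s', t')" by (metis prod.exhaust)
    have "f d u = f d' u" "f d p = f d' p" "f d q = f d' q" using eq by auto
    then show "d = d'" using d ne pqr(4) by (auto simp: f_def max_def split: if_splits)
  qed
  have "continuous_on D f"
  proof (rule continuous_on_coordinatewise_then_product)
    fix z
    show "continuous_on D (\<lambda>d. f d z)"
      unfolding f_def case_prod_unfold
      by (cases "z = u"; cases "z = v"; cases "z = p"; cases "z = q")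
        (auto intro!: continuous_intros)
  qed
  then have "openin (top_of_set (body K)) (f ` D)"
    using openin_embedded_disc[OF X D _ inj sub] by blast
  then obtain G where G: "open G" "f ` D = body K \<inter> G" unfolding openin_open by blast
  \<comment> \<open>A path from the midpoint of the edge into the triangle of \<open>r\<close>.\<close>
  define \<gamma> where "\<gamma> \<epsilon> = (\<lambda>z. if z = u \<or> z = v then 1/2 - \<epsilon>/2 else if z = r then \<epsilon> else (0::real))" for \<epsilon>
  have "continuous_on UNIV \<gamma>"
  proof (rule continuous_on_coordinatewise_then_product)
    fix z
    show "continuous_on UNIV (\<lambda>\<epsilon>. \<gamma> \<epsilon> z)"
      unfolding \<gamma>_def by (cases "z = u \<or> z = v"; cases "z = r") (auto intro!: continuous_intros)
  qed
  then have op: "open (\<gamma> -` G)" using G(1) by (simp add: open_vimage)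
  have "(0, 0) \<in> D" by (simp add: D_def)
  then have "f (0, 0) \<in> G" using G(2) by blast
  moreover have "\<gamma> 0 = f (0, 0)" by (auto simp: f_def \<gamma>_def)
  ultimately have "0 \<in> \<gamma> -` G" by simp
  from openE[OF op this] obtain e where e: "0 < e" "ball 0 e \<subseteq> \<gamma> -` G" .
  define \<epsilon> where "\<epsilon> = min (e/2) (1/2)"
  have \<epsilon>: "0 < \<epsilon>" "\<epsilon> < e" "\<epsilon> \<le> 1/2" using e(1) by (auto simp: \<epsilon>_def)
  have "\<gamma> \<epsilon> \<in> body K"
  proof (rule bodyI[OF K])
    show "{r, u, v} \<in> K" using pqr(3) by (simp add: apexes_def)
  qed (use \<epsilon> ne uv in \<open>auto simp: \<gamma>_def\<close>)
  moreover have "\<gamma> \<epsilon> \<in> G" using e(2) \<epsilon> by (auto simp: subset_iff)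
  ultimately obtain d where "\<gamma> \<epsilon> = f d" using G(2) by blast
  then have "\<gamma> \<epsilon> r = f d r" by simp
  then show False using \<epsilon>(1) ne pqr by (auto simp: \<gamma>_def f_def split: prod.splits)
qed

section \<open>Balanced closed surfaces\<close>

text \<open>Used below in the form: two 2-element subsets of a set with at most three elements meet.\<close>

lemma Int_nonempty_of_card:
  assumes "finite C" "A \<subseteq> C" "B \<subseteq> C" "card C < card A + card B"
  shows "A \<inter> B \<noteq> {}"
proof
  assume "A \<inter> B = {}"
  then have "card (A \<union> B) = card A + card B"
    using assms finite_subset card_Un_disjoint by metis
  moreover have "card (A \<union> B) \<le> card C" using assms by (intro card_mono) auto
  ultimately show False using assms(4) by simp
qed

text \<open>The combinatorial properties of a 3-coloured triangulated surface on which the counting rests.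
Connectedness of vertex links is derived where it is used, for links with few vertices.\<close>

locale balanced_closed_surface =
  fixes K :: "'a set set" and \<kappa> :: "'a \<Rightarrow> nat"
  assumes complex: "abstract_simplicial_complex K"
    and nonvoid: "\<exists>v. {v} \<in> K"
    and colour_range: "\<And>v. {v} \<in> K \<Longrightarrow> \<kappa> v \<in> {1, 2, 3}"
    and colour_edge: "\<And>u v. u \<noteq> v \<Longrightarrow> {u, v} \<in> K \<Longrightarrow> \<kappa> u \<noteq> \<kappa> v"
    and vertex_edge: "\<And>u. {u} \<in> K \<Longrightarrow> \<exists>v. v \<noteq> u \<and> {u, v} \<in> K"
    and card_apexes: "\<And>u v. u \<noteq> v \<Longrightarrow> {u, v} \<in> K \<Longrightarrow> card (apexes K {u, v}) = 2"
begin

lemmas face = abstract_simplicial_complexD(4)[OF complex]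

lemma finite_K: "finite K" and finite_face: "\<sigma> \<in> K \<Longrightarrow> finite \<sigma>"
  using abstract_simplicial_complexD[OF complex] by blast+

lemma subface:
  "{u, v, w} \<in> K \<Longrightarrow> {u, v} \<in> K \<and> {u, w} \<in> K \<and> {v, w} \<in> K"
  "{u, v} \<in> K \<Longrightarrow> {u} \<in> K \<and> {v} \<in> K"
proof -
  assume K: "{u, v, w} \<in> K"
  show "{u, v} \<in> K \<and> {u, w} \<in> K \<and> {v, w} \<in> K"
    by (intro conjI face[OF K]) auto
next
  assume K: "{u, v} \<in> K"
  show "{u} \<in> K \<and> {v} \<in> K"
    by (intro conjI face[OF K]) auto
qed

definition colour_class :: "nat \<Rightarrow> 'a set" where
  "colour_class i = {v. {v} \<in> K \<and> \<kappa> v = i}"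

definition neighbours :: "nat \<Rightarrow> 'a \<Rightarrow> 'a set" where
  "neighbours i a = {v \<in> colour_class i. {a, v} \<in> K}"

text \<open>An enumeration of the three colours. Lemmas are stated for an arbitrary enumeration
where the symmetry between the colours is to be exploited.\<close>

definition palette :: "nat \<Rightarrow> nat \<Rightarrow> nat \<Rightarrow> bool" where
  "palette i j k \<longleftrightarrow> {i, j, k} = {1, 2, 3}"

lemma palette_distinct:
  assumes "palette i j k"
  shows "i \<noteq> j" "i \<noteq> k" "j \<noteq> k"
proof -
  have "card {i, j, k} = 3" using assms by (simp add: palette_def)
  then show "i \<noteq> j" "i \<noteq> k" "j \<noteq> k" by (auto simp: card_insert_if split: if_splits)
qed

lemma palette_perm: "palette i j k \<Longrightarrow> palette i k j" "palette i j k \<Longrightarrow> palette k i j"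
  by (auto simp: palette_def insert_commute)

lemma colour_cases: "palette i j k \<Longrightarrow> {v} \<in> K \<Longrightarrow> \<kappa> v = i \<or> \<kappa> v = j \<or> \<kappa> v = k"
  using colour_range[of v] unfolding palette_def by blast

lemma finite_colour_class: "finite (colour_class i)"
proof (rule finite_subset)
  show "colour_class i \<subseteq> \<Union>K" by (auto simp: colour_class_def)
  show "finite (\<Union>K)" using finite_K finite_face by blast
qed

lemma finite_neighbours: "finite (neighbours i a)"
  unfolding neighbours_def using finite_colour_class by simp

lemma same_colour_not_adjacent:
  "a \<in> colour_class i \<Longrightarrow> b \<in> colour_class i \<Longrightarrow> {a, b} \<in> K \<Longrightarrow> a = b"
  using colour_edge[of a b] by (auto simp: colour_class_def)

lemma apexes_colour:
  assumes p: "palette i j k" and a: "a \<in> colour_class i" and b: "b \<in> neighbours j a"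
  shows "apexes K {a, b} = {c \<in> colour_class k. {a, b, c} \<in> K}"
proof
  show "apexes K {a, b} \<subseteq> {c \<in> colour_class k. {a, b, c} \<in> K}"
  proof
    fix c assume "c \<in> apexes K {a, b}"
    moreover have "insert c {a, b} = {a, b, c}" by auto
    ultimately have c: "c \<noteq> a" "c \<noteq> b" "{a, b, c} \<in> K" by (auto simp: apexes_def)
    then have "\<kappa> c \<noteq> \<kappa> a" "\<kappa> c \<noteq> \<kappa> b" "{c} \<in> K"
      using colour_edge[of a c] colour_edge[of b c] subface(1)[OF c(3)] subface(2)[of a c] by auto
    then show "c \<in> {c \<in> colour_class k. {a, b, c} \<in> K}"
      using c a b colour_cases[OF p, of c] by (auto simp: colour_class_def neighbours_def)
  qed
  show "{c \<in> colour_class k. {a, b, c} \<in> K} \<subseteq> apexes K {a, b}"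
  proof
    fix c assume c: "c \<in> {c \<in> colour_class k. {a, b, c} \<in> K}"
    have "insert c {a, b} = {a, b, c}" by auto
    moreover have "c \<noteq> a" "c \<noteq> b"
      using a b c palette_distinct[OF p] by (auto simp: colour_class_def neighbours_def)
    ultimately show "c \<in> apexes K {a, b}" using c by (simp add: apexes_def)
  qed
qed

lemma card_apexes_neighbour:
  assumes "palette i j k" "a \<in> colour_class i" "b \<in> neighbours j a"
  shows "card (apexes K {a, b}) = 2"
proof (rule card_apexes)
  show "a \<noteq> b" using assms palette_distinct[OF assms(1)]
    by (auto simp: colour_class_def neighbours_def)
  show "{a, b} \<in> K" using assms(3) by (simp add: neighbours_def)
qed

lemma apexes_subset_neighbours:
  assumes "palette i j k" "a \<in> colour_class i" "b \<in> neighbours j a"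
  shows "apexes K {a, b} \<subseteq> neighbours k a" "apexes K {a, b} \<subseteq> neighbours k b"
proof -
  have "c \<in> neighbours k a \<inter> neighbours k b" if "c \<in> apexes K {a, b}" for c
  proof -
    have c: "c \<in> colour_class k" "{a, b, c} \<in> K" using that apexes_colour[OF assms] by auto
    then show ?thesis using subface(1)[OF c(2)] by (simp add: neighbours_def)
  qed
  then show "apexes K {a, b} \<subseteq> neighbours k a" "apexes K {a, b} \<subseteq> neighbours k b" by auto
qed

text \<open>The link of \<open>a\<close> is a 2-regular bipartite graph on the two sets, so that both numbers are half the
number of its edges.\<close>

lemma card_neighbours_eq:
  assumes p: "palette i j k" and a: "a \<in> colour_class i"
  shows "card (neighbours j a) = card (neighbours k a)"
proof -
  let ?L = "SIGMA b:neighbours j a. apexes K {a, b}"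
  let ?M = "SIGMA c:neighbours k a. apexes K {a, c}"
  note p' = palette_perm(1)[OF p]
  have fin: "finite (apexes K e)" for e using finite_apexes[OF complex] .
  have swap: "prod.swap z \<in> (SIGMA c:neighbours n a. apexes K {a, c})"
    if q: "palette i m n" and z: "z \<in> (SIGMA b:neighbours m a. apexes K {a, b})" for m n z
  proof -
    obtain b c where bc: "z = (b, c)" "b \<in> neighbours m a" "c \<in> apexes K {a, b}" using z by auto
    then have "{a, b, c} \<in> K" using apexes_colour[OF q a] by auto
    moreover have c: "c \<in> neighbours n a" using apexes_subset_neighbours(1)[OF q a] bc by blast
    moreover have "b \<in> colour_class m" using bc(2) by (simp add: neighbours_def)
    ultimately have "b \<in> apexes K {a, c}"
      using apexes_colour[OF palette_perm(1)[OF q] a c] by (simp add: insert_commute[of c b])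
    then show ?thesis using bc(1) c by simp
  qed
  have "prod.swap ` ?L = ?M"
  proof
    show "prod.swap ` ?L \<subseteq> ?M" using swap[OF p] by blast
    show "?M \<subseteq> prod.swap ` ?L"
    proof
      fix z assume "z \<in> ?M"
      then have "prod.swap z \<in> ?L" by (rule swap[OF p'])
      then show "z \<in> prod.swap ` ?L" by (metis image_eqI swap_swap)
    qed
  qed
  then have "card ?L = card ?M" by (metis card_image inj_on_subset inj_swap subset_UNIV)
  moreover have "card ?L = 2 * card (neighbours j a)"
    using card_apexes_neighbour[OF p a] fin finite_neighbours by simp
  moreover have "card ?M = 2 * card (neighbours k a)"
    using card_apexes_neighbour[OF p' a] fin finite_neighbours by simp
  ultimately have "2 * card (neighbours j a) = 2 * card (neighbours k a)" by metis
  then show ?thesis by simp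
qed

text \<open>A neighbour of \<open>a\<close> yields two further ones, the apexes of the edge between them, which have the
third colour; and the two numbers of neighbours are equal.\<close>

lemma two_le_card_neighbours:
  assumes p: "palette i j k" and a: "a \<in> colour_class i"
  shows "2 \<le> card (neighbours j a)"
proof -
  obtain v where v: "v \<noteq> a" "{a, v} \<in> K"
    using vertex_edge[of a] a unfolding colour_class_def by blast
  then have "\<kappa> v \<noteq> i" "{v} \<in> K" using colour_edge[of a v] a subface(2)[OF v(2)] by (auto simp: colour_class_def)
  then consider "v \<in> neighbours j a" | "v \<in> neighbours k a"
    using v colour_cases[OF p, of v] by (auto simp: neighbours_def colour_class_def)
  then show ?thesis
  proof cases
    case 1
    then show ?thesis
      using card_apexes_neighbour[OF p a] apexes_subset_neighbours[OF p a] finite_neighbours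
        card_mono card_neighbours_eq[OF p a] by metis
  next
    case 2
    note p' = palette_perm(1)[OF p]
    show ?thesis
      using card_apexes_neighbour[OF p' a 2] apexes_subset_neighbours[OF p' a 2] finite_neighbours
        card_mono by metis
  qed
qed

definition link :: "'a \<Rightarrow> 'a set set" where
  "link a = {\<sigma>. a \<notin> \<sigma> \<and> insert a \<sigma> \<in> K}"

lemma abstract_simplicial_complex_link:
  assumes "{a} \<in> K"
  shows "abstract_simplicial_complex (link a)"
proof -
  have "link a \<subseteq> K" using face by (auto simp: link_def)
  then have "finite (link a)" "\<forall>\<sigma>\<in>link a. finite \<sigma>"
    using finite_K finite_face finite_subset by blast+
  moreover have "\<tau> \<in> link a" if "\<sigma> \<in> link a" "\<tau> \<subseteq> \<sigma>" for \<sigma> \<tau>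
    using that face[of "insert a \<sigma>" "insert a \<tau>"] by (auto simp: link_def)
  moreover have "{} \<in> link a" using assms by (simp add: link_def)
  ultimately show ?thesis unfolding abstract_simplicial_complex_def by blast
qed

text \<open>Since every edge at \<open>a\<close> lies in a triangle, every face of the link extends to an edge.\<close>

lemma link_pure:
  assumes p: "palette i j k" and a: "a \<in> colour_class i" and \<sigma>: "\<sigma> \<in> link a"
  obtains b c where "b \<in> neighbours j a" "c \<in> neighbours k a" "{a, b, c} \<in> K" "\<sigma> \<subseteq> {b, c}"
proof -
  note p' = palette_perm(1)[OF p]
  have K: "insert a \<sigma> \<in> K" and a\<sigma>: "a \<notin> \<sigma>" using \<sigma> by (auto simp: link_def)
  have ak: "\<kappa> a = i" "{a} \<in> K" using a by (auto simp: colour_class_def)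
  have nb: "v \<in> neighbours j a \<or> v \<in> neighbours k a" if "v \<in> \<sigma>" for v
  proof -
    have "{a, v} \<in> K" "a \<noteq> v" using face[OF K, of "{a, v}"] that a\<sigma> by auto
    then have "\<kappa> v \<noteq> i" "{v} \<in> K" using colour_edge[of a v] ak subface(2)[of a v] by auto
    then show ?thesis
      using \<open>{a, v} \<in> K\<close> colour_cases[OF p, of v] by (auto simp: neighbours_def colour_class_def)
  qed
  have eq: "v = w" if "v \<in> \<sigma>" "w \<in> \<sigma>" "\<kappa> v = \<kappa> w" for v w
    using face[OF K, of "{v, w}"] colour_edge[of v w] that by auto
  have jk: "\<kappa> v = m" if "v \<in> neighbours m a" for v m
    using that by (simp add: neighbours_def colour_class_def)
  consider "\<exists>b\<in>\<sigma>. b \<in> neighbours j a" | "\<exists>c\<in>\<sigma>. c \<in> neighbours k a" | "\<sigma> = {}"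
    using nb by blast
  then show thesis
  proof cases
    case 1
    then obtain b where b: "b \<in> \<sigma>" "b \<in> neighbours j a" by blast
    show thesis
    proof (cases "\<exists>c\<in>\<sigma>. c \<in> neighbours k a")
      case True
      then obtain c where c: "c \<in> \<sigma>" "c \<in> neighbours k a" by blast
      have "\<sigma> \<subseteq> {b, c}" using nb eq jk b c by blast
      moreover have "{a, b, c} \<in> K" using face[OF K, of "{a, b, c}"] b c by auto
      ultimately show ?thesis using that b c by blast
    next
      case False
      have "apexes K {a, b} \<noteq> {}" using card_apexes_neighbour[OF p a b(2)] by auto
      then obtain c where c: "c \<in> apexes K {a, b}" by blast
      have "\<sigma> \<subseteq> {b, c}" using nb eq jk b False by blast
      then show ?thesis
        using that[OF b(2), of c] c apexes_subset_neighbours[OF p a b(2)] apexes_colour[OF p a b(2)]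
        by blast
    qed
  next
    case 2
    then obtain c where c: "c \<in> \<sigma>" "c \<in> neighbours k a" by blast
    show thesis
    proof (cases "\<exists>b\<in>\<sigma>. b \<in> neighbours j a")
      case True
      then obtain b where b: "b \<in> \<sigma>" "b \<in> neighbours j a" by blast
      have "\<sigma> \<subseteq> {b, c}" using nb eq jk b c by blast
      moreover have "{a, b, c} \<in> K" using face[OF K, of "{a, b, c}"] b c by auto
      ultimately show ?thesis using that b c by blast
    next
      case False
      have "apexes K {a, c} \<noteq> {}" using card_apexes_neighbour[OF p' a c(2)] by auto
      then obtain b where b: "b \<in> apexes K {a, c}" by blast
      have "\<sigma> \<subseteq> {b, c}" using nb eq jk c False by blast
      then show ?thesis
        using that[OF _ c(2), of b] b apexes_subset_neighbours[OF p' a c(2)] apexes_colour[OF p' a c(2)]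
        by (auto simp: insert_commute[of c b])
    qed
  next
    case 3
    have "neighbours j a \<noteq> {}" using two_le_card_neighbours[OF p a] by auto
    then obtain b where b: "b \<in> neighbours j a" by blast
    have "apexes K {a, b} \<noteq> {}" using card_apexes_neighbour[OF p a b] by auto
    then obtain c where "c \<in> apexes K {a, b}" by blast
    then show ?thesis
      using that[OF b, of c] 3 apexes_subset_neighbours[OF p a b] apexes_colour[OF p a b] by blast
  qed
qed

lemma apexes_opposite_edge:
  assumes p: "palette i j k" and a: "a \<in> colour_class i"
    and b: "b \<in> neighbours j a" and c: "c \<in> neighbours k a" and abc: "{a, b, c} \<in> K"
  shows "a \<in> apexes K {b, c}" "apexes K {b, c} \<subseteq> colour_class i" "card (apexes K {b, c}) = 2"
proof -
  have bc: "palette j k i" using palette_perm[OF palette_perm(2)[OF p]] palette_perm p by blast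
  have b': "b \<in> colour_class j" using b by (simp add: neighbours_def)
  have c': "c \<in> neighbours k b" using c subface(1)[OF abc] by (simp add: neighbours_def)
  show "apexes K {b, c} \<subseteq> colour_class i" "card (apexes K {b, c}) = 2"
    using apexes_colour[OF bc b' c'] card_apexes_neighbour[OF bc b' c'] by auto
  show "a \<in> apexes K {b, c}"
    using apexes_colour[OF bc b' c'] a abc by (simp add: insert_commute)
qed

text \<open>Vertices of the same colour are not adjacent, so that a face of two stars avoids both centres.
Conversely, an edge of the link lies in a second triangle, whose apex has the colour of \<open>a\<close>.\<close>

lemma closed_star_Int_others:
  assumes p: "palette i j k" and a: "a \<in> colour_class i"
  shows "closed_star K a \<inter> (\<Union>a'\<in>colour_class i - {a}. closed_star K a') = link a"
proof
  show "closed_star K a \<inter> (\<Union>a'\<in>colour_class i - {a}. closed_star K a') \<subseteq> link a"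
  proof
    fix \<sigma> assume "\<sigma> \<in> closed_star K a \<inter> (\<Union>a'\<in>colour_class i - {a}. closed_star K a')"
    then obtain a' where a': "a' \<in> colour_class i" "a' \<noteq> a" "insert a \<sigma> \<in> K" "insert a' \<sigma> \<in> K"
      by (auto simp: closed_star_def)
    have "a \<notin> \<sigma>"
    proof
      assume "a \<in> \<sigma>"
      then have "{a, a'} \<in> K" using face[OF a'(4), of "{a, a'}"] by auto
      then show False using same_colour_not_adjacent[OF a a'(1)] a'(2) by simp
    qed
    then show "\<sigma> \<in> link a" using a'(3) by (simp add: link_def)
  qed
  show "link a \<subseteq> closed_star K a \<inter> (\<Union>a'\<in>colour_class i - {a}. closed_star K a')"
  proof
    fix \<sigma> assume \<sigma>: "\<sigma> \<in> link a"
    obtain b c where bc: "b \<in> neighbours j a" "c \<in> neighbours k a" "{a, b, c} \<in> K" "\<sigma> \<subseteq> {b, c}"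
      using link_pure[OF p a \<sigma>] .
    note ap = apexes_opposite_edge[OF p a bc(1-3)]
    have "\<not> apexes K {b, c} \<subseteq> {a}"
      using ap(3) card_mono[of "{a}" "apexes K {b, c}"] by auto
    then obtain a' where a': "a' \<in> apexes K {b, c}" "a' \<noteq> a" by blast
    then have "insert a' {b, c} \<in> K" by (simp add: apexes_def)
    then have "\<sigma> \<in> closed_star K a'"
      using bc(4) face[of "insert a' {b, c}" "insert a' \<sigma>"] by (auto simp: closed_star_def)
    moreover have "\<sigma> \<in> closed_star K a" using \<sigma> by (simp add: link_def closed_star_def)
    ultimately show "\<sigma> \<in> closed_star K a \<inter> (\<Union>a'\<in>colour_class i - {a}. closed_star K a')"
      using a' ap(2) by blast
  qed
qed

text \<open>Every face extends to a triangle, and a triangle has a vertex of each colour.\<close>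

lemma closed_stars_cover:
  assumes p: "palette i j k"
  shows "(\<Union>a\<in>colour_class i. closed_star K a) = K"
proof
  show "(\<Union>a\<in>colour_class i. closed_star K a) \<subseteq> K"
    using closed_star_subset[OF complex] by blast
  have vert: "\<exists>a\<in>colour_class i. \<sigma> \<in> closed_star K a" if \<sigma>: "\<sigma> \<in> K" "v \<in> \<sigma>" for \<sigma> v
  proof (cases "\<exists>a\<in>\<sigma>. \<kappa> a = i")
    case True
    then obtain a where "a \<in> \<sigma>" "\<kappa> a = i" by blast
    then show ?thesis
      using \<sigma> face[OF \<sigma>(1), of "{a}"] by (auto simp: colour_class_def closed_star_def insert_absorb)
  next
    case False
    have vK: "{v} \<in> K" using face[OF \<sigma>(1), of "{v}"] \<sigma>(2) by auto
    obtain j' k' where p': "palette j' k' i" "\<kappa> v = j'"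
    proof -
      have "palette j k i" "palette k j i" using palette_perm p by blast+
      then show thesis using that colour_cases[OF p vK] False \<sigma>(2) by blast
    qed
    have v: "v \<in> colour_class j'" using vK p' by (simp add: colour_class_def)
    have "insert v (\<sigma> - {v}) \<in> K" using \<sigma> by (simp add: insert_absorb)
    then have "\<sigma> - {v} \<in> link v" by (simp add: link_def)
    then obtain b a where ba: "a \<in> neighbours i v" "{v, b, a} \<in> K" "\<sigma> - {v} \<subseteq> {b, a}"
      using link_pure[OF p'(1) v] by metis
    have "\<sigma> \<subseteq> {v, b}" using ba False by (auto simp: neighbours_def colour_class_def)
    then have "insert a \<sigma> \<in> K" using face[OF ba(2), of "insert a \<sigma>"] by auto
    then show ?thesis using ba(1) by (auto simp: closed_star_def neighbours_def)
  qed
  obtain v where v: "{v} \<in> K" using nonvoid by blast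
  obtain a where "a \<in> colour_class i" using vert[OF v] by blast
  then have "{} \<in> (\<Union>a\<in>colour_class i. closed_star K a)"
    by (auto simp: closed_star_def colour_class_def)
  then show "K \<subseteq> (\<Union>a\<in>colour_class i. closed_star K a)"
    using vert by blast
qed

text \<open>Each \<open>j\<close>-coloured vertex of the link is joined to two of the at most three \<open>k\<close>-coloured ones, so
that any two of them have a common neighbour in the link.\<close>

lemma connected_link:
  assumes p: "palette i j k" and a: "a \<in> colour_class i" and le3: "card (neighbours k a) \<le> 3"
  shows "connected (body (link a))"
proof (rule connected_body)
  have aK: "{a} \<in> K" using a by (simp add: colour_class_def)
  then show link: "abstract_simplicial_complex (link a)" by (rule abstract_simplicial_complex_link)
  let ?R = "{(u, v). {u, v} \<in> link a}"
  have sym: "(u, v) \<in> ?R\<^sup>*" if "(v, u) \<in> ?R\<^sup>*" for u v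
  proof -
    have "sym ?R" by (auto simp: sym_def insert_commute)
    then show ?thesis using that sym_rtrancl symD by metis
  qed
  have step: "(b, c) \<in> ?R" if "b \<in> neighbours j a" "c \<in> apexes K {a, b}" for b c
    using that apexes_colour[OF p a] a palette_distinct[OF p]
    by (auto simp: link_def neighbours_def colour_class_def)
  have meet: "(b, b') \<in> ?R\<^sup>*" if b: "b \<in> neighbours j a" "b' \<in> neighbours j a" for b b'
  proof -
    have "apexes K {a, b} \<inter> apexes K {a, b'} \<noteq> {}"
      by (rule Int_nonempty_of_card[of "neighbours k a"])
        (use b le3 apexes_subset_neighbours[OF p a] card_apexes_neighbour[OF p a] finite_neighbours
          in \<open>auto simp: subset_iff\<close>)
    then obtain c where "c \<in> apexes K {a, b}" "c \<in> apexes K {a, b'}" by blast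
    then have "(b, c) \<in> ?R" "(b', c) \<in> ?R" using step b by blast+
    then show ?thesis using sym[of b' c] by (meson r_into_rtrancl rtrancl_trans sym)
  qed
  have to_j: "\<exists>b\<in>neighbours j a. (u, b) \<in> ?R\<^sup>*" if u: "{u} \<in> link a" for u
  proof -
    obtain b c where bc: "b \<in> neighbours j a" "c \<in> neighbours k a" "{a, b, c} \<in> K" "{u} \<subseteq> {b, c}"
      using link_pure[OF p a u] .
    then have "c \<in> apexes K {a, b}" using apexes_colour[OF p a bc(1)] by (auto simp: neighbours_def)
    then have "(b, c) \<in> ?R" using step bc(1) by blast
    then have "(c, b) \<in> ?R\<^sup>*" using sym by (meson r_into_rtrancl)
    then show ?thesis using bc by auto
  qed
  show "(u, v) \<in> ?R\<^sup>*" if uv: "{u} \<in> link a" "{v} \<in> link a" for u v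
  proof -
    obtain b b' where b: "b \<in> neighbours j a" "(u, b) \<in> ?R\<^sup>*"
      and b': "b' \<in> neighbours j a" "(v, b') \<in> ?R\<^sup>*"
      using to_j[OF uv(1)] to_j[OF uv(2)] by blast
    show ?thesis
      by (rule rtrancl_trans[OF rtrancl_trans[OF b(2) meet[OF b(1) b'(1)]] sym[OF b'(2)]])
  qed
qed

text \<open>The links of \<open>x\<close> and \<open>y\<close> are complete bipartite graphs on 2 + 2 vertices. As there are at most
three vertices of either colour, they share vertices of both colours, and the intersection is
the complete bipartite graph on the shared vertices.\<close>

lemma connected_closed_star_Int:
  assumes p: "palette i j k" and xy: "x \<in> colour_class i" "y \<in> colour_class i" "x \<noteq> y"
    and small: "card (colour_class j) \<le> 3" "card (colour_class k) \<le> 3"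
    and two: "card (neighbours k x) = 2" "card (neighbours k y) = 2"
  shows "connected (body (closed_star K x \<inter> closed_star K y))"
proof (rule connected_body)
  let ?S = "closed_star K x \<inter> closed_star K y"
  show "abstract_simplicial_complex ?S"
    using xy by (intro abstract_simplicial_complex_Int abstract_simplicial_complex_closed_star complex)
      (auto simp: colour_class_def)
  let ?R = "{(u, v). {u, v} \<in> ?S}"
  define B where "B = neighbours j x \<inter> neighbours j y"
  define C where "C = neighbours k x \<inter> neighbours k y"
  have all: "apexes K {a, b} = neighbours k a"
    if "a \<in> {x, y}" "b \<in> neighbours j a" for a b
  proof (rule card_subset_eq[OF finite_neighbours])
    have a: "a \<in> colour_class i" using that(1) xy by auto
    show "apexes K {a, b} \<subseteq> neighbours k a"
      using apexes_subset_neighbours(1)[OF p a that(2)] .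
    show "card (apexes K {a, b}) = card (neighbours k a)"
      using card_apexes_neighbour[OF p a that(2)] that(1) two by auto
  qed
  have edge: "{b, c} \<in> ?S" if "b \<in> B" "c \<in> C" for b c
  proof -
    have "c \<in> apexes K {x, b}" "c \<in> apexes K {y, b}"
      using that all[of x b] all[of y b] by (auto simp: B_def C_def)
    moreover have "insert c {x, b} = insert x {b, c}" "insert c {y, b} = insert y {b, c}" by auto
    ultimately show ?thesis by (simp add: apexes_def closed_star_def)
  qed
  have two': "card (neighbours j x) = 2" "card (neighbours j y) = 2"
    using card_neighbours_eq[OF p] xy two by auto
  have "B \<noteq> {}" unfolding B_def
    by (rule Int_nonempty_of_card[OF finite_colour_class[of j]])
      (use two' small in \<open>auto simp: neighbours_def\<close>)
  then obtain b0 where b0: "b0 \<in> B" by blast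
  have "C \<noteq> {}" unfolding C_def
    by (rule Int_nonempty_of_card[OF finite_colour_class[of k]])
      (use two small in \<open>auto simp: neighbours_def\<close>)
  then obtain c0 where c0: "c0 \<in> C" by blast
  have BC: "u \<in> B \<or> u \<in> C" if u: "{u} \<in> ?S" for u
  proof -
    have K: "{x, u} \<in> K" "{y, u} \<in> K" using u by (auto simp: closed_star_def)
    have "{x, y} \<notin> K" using same_colour_not_adjacent xy by blast
    then have "u \<noteq> x" "u \<noteq> y" using K by (auto simp: insert_commute)
    then have "\<kappa> u \<noteq> i" "{u} \<in> K"
      using colour_edge[of x u] K xy subface(2)[OF K(1)] by (auto simp: colour_class_def)
    then show ?thesis using colour_cases[OF p, of u] K
      by (auto simp: B_def C_def neighbours_def colour_class_def)
  qed
  have sym: "(u, v) \<in> ?R\<^sup>*" if "(v, u) \<in> ?R\<^sup>*" for u v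
  proof -
    have "sym ?R" by (auto simp: sym_def insert_commute)
    then show ?thesis using that sym_rtrancl symD by metis
  qed
  have base: "(u, b0) \<in> ?R\<^sup>*" if u: "{u} \<in> ?S" for u
    using BC[OF u]
  proof
    assume "u \<in> B"
    then have uc: "(u, c0) \<in> ?R\<^sup>*" and bc: "(b0, c0) \<in> ?R\<^sup>*"
      using edge c0 b0 by (auto intro!: r_into_rtrancl)
    show ?thesis by (rule rtrancl_trans[OF uc sym[OF bc]])
  next
    assume "u \<in> C"
    then have "(b0, u) \<in> ?R\<^sup>*" using edge b0 by (auto intro!: r_into_rtrancl)
    then show ?thesis by (rule sym)
  qed
  show "(u, v) \<in> ?R\<^sup>*" if "{u} \<in> ?S" "{v} \<in> ?S" for u v
    using base[OF that(1)] sym[OF base[OF that(2)]] by (rule rtrancl_trans)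
qed

section \<open>Counting faces by colours\<close>

definition triangles :: "'a set set" where
  "triangles = {\<sigma> \<in> K. card \<sigma> = 3}"

definition edges :: "'a set set" where
  "edges = {\<sigma> \<in> K. card \<sigma> = 2}"

text \<open>Double counting of the pairs of an edge and a triangle that contains it.\<close>

lemma card_edges: "2 * card edges = 3 * card triangles"
proof -
  let ?L = "SIGMA e:edges. apexes K e"
  let ?M = "SIGMA \<sigma>:triangles. \<sigma>"
  have fin: "finite edges" "finite triangles" using finite_K by (auto simp: edges_def triangles_def)
  have two: "card (apexes K e) = 2" if "e \<in> edges" for e
    using that card_apexes by (auto simp: edges_def card_2_iff)
  have "bij_betw (\<lambda>(e, w). (insert w e, w)) ?L ?M"
  proof (rule bij_betw_byWitness[where f' = "\<lambda>(\<sigma>, w). (\<sigma> - {w}, w)"])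
    show "\<forall>z\<in>?L. (\<lambda>(\<sigma>, w). (\<sigma> - {w}, w)) ((\<lambda>(e, w). (insert w e, w)) z) = z"
      by (auto simp: apexes_def)
    show "\<forall>z\<in>?M. (\<lambda>(e, w). (insert w e, w)) ((\<lambda>(\<sigma>, w). (\<sigma> - {w}, w)) z) = z"
      by auto
    show "(\<lambda>(e, w). (insert w e, w)) ` ?L \<subseteq> ?M"
      using finite_face by (auto simp: apexes_def edges_def triangles_def)
    show "(\<lambda>(\<sigma>, w). (\<sigma> - {w}, w)) ` ?M \<subseteq> ?L"
      using face by (auto simp: apexes_def edges_def triangles_def insert_absorb)
  qed
  then have "card ?L = card ?M" by (rule bij_betw_same_card)
  moreover have "card ?L = 2 * card edges"
    using fin two finite_apexes[OF complex] by simp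
  moreover have "card ?M = 3 * card triangles"
    using fin finite_face by (subst card_SigmaI) (auto simp: triangles_def)
  ultimately show ?thesis by simp
qed

lemma triangle_colours:
  assumes p: "palette i j k" and \<sigma>: "\<sigma> \<in> triangles"
  obtains a b c where "a \<in> colour_class i" "b \<in> colour_class j" "c \<in> colour_class k" "\<sigma> = {a, b, c}"
proof -
  have K: "\<sigma> \<in> K" "card \<sigma> = 3" "finite \<sigma>" using \<sigma> finite_face by (auto simp: triangles_def)
  have "inj_on \<kappa> \<sigma>"
    using face[OF K(1)] colour_edge by (intro inj_onI) (metis bot.extremum insert_subset)
  then have "card (\<kappa> ` \<sigma>) = 3" using K by (simp add: card_image)
  moreover have v: "{v} \<in> K" if "v \<in> \<sigma>" for v using face[OF K(1), of "{v}"] that by auto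
  then have "\<kappa> ` \<sigma> \<subseteq> {i, j, k}" using colour_cases[OF p] by blast
  moreover have "card {i, j, k} = 3" using palette_distinct[OF p] by auto
  ultimately have im: "\<kappa> ` \<sigma> = {i, j, k}" by (intro card_subset_eq) auto
  then obtain a b c where abc: "a \<in> \<sigma>" "\<kappa> a = i" "b \<in> \<sigma>" "\<kappa> b = j" "c \<in> \<sigma>" "\<kappa> c = k"
    by (metis imageE insertI1 insertI2)
  then have "a \<noteq> b" "a \<noteq> c" "b \<noteq> c" using palette_distinct[OF p] by auto
  then have "card {a, b, c} = 3" by simp
  then have "{a, b, c} = \<sigma>" using abc K by (intro card_subset_eq) auto
  then show thesis using that abc v by (auto simp: colour_class_def)
qed

text \<open>Each triangle contains exactly one edge with the colours \<open>i\<close> and \<open>j\<close>, and this edge lies in two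
triangles.\<close>

lemma card_triangles:
  assumes p: "palette i j k"
  shows "card triangles = 2 * (\<Sum>a\<in>colour_class i. card (neighbours j a))"
proof -
  let ?E = "SIGMA a:colour_class i. neighbours j a"
  let ?T = "SIGMA e:?E. apexes K {fst e, snd e}"
  have "bij_betw (\<lambda>((a, b), c). {a, b, c}) ?T triangles"
    unfolding bij_betw_def
  proof
    have ap: "c \<in> colour_class k \<and> {a, b, c} \<in> K"
      if "a \<in> colour_class i" "b \<in> neighbours j a" "c \<in> apexes K {a, b}" for a b c
      using that(3) unfolding apexes_colour[OF p that(1,2)] by simp
    show "inj_on (\<lambda>((a, b), c). {a, b, c}) ?T"
    proof (rule inj_onI)
      fix z z' assume z: "z \<in> ?T" and z': "z' \<in> ?T"
        and eq: "(\<lambda>((a, b), c). {a, b, c}) z = (\<lambda>((a, b), c). {a, b, c}) z'"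
      obtain a b c where abc: "z = ((a, b), c)" "a \<in> colour_class i" "b \<in> neighbours j a"
        "c \<in> apexes K {a, b}" using z by auto
      obtain a' b' c' where abc': "z' = ((a', b'), c')" "a' \<in> colour_class i" "b' \<in> neighbours j a'"
        "c' \<in> apexes K {a', b'}" using z' by auto
      have col: "\<kappa> a = i" "\<kappa> b = j" "\<kappa> c = k" "\<kappa> a' = i" "\<kappa> b' = j" "\<kappa> c' = k"
        using ap[OF abc(2-4)] ap[OF abc'(2-4)] abc(2,3) abc'(2,3)
        by (auto simp: colour_class_def neighbours_def)
      have "a \<in> {a', b', c'}" "b \<in> {a', b', c'}" "c \<in> {a', b', c'}"
        using eq abc(1) abc'(1) by auto
      then have "a = a'" "b = b'" "c = c'" using col palette_distinct[OF p] by auto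
      then show "z = z'" using abc(1) abc'(1) by simp
    qed
    show "(\<lambda>((a, b), c). {a, b, c}) ` ?T = triangles"
    proof
      show "(\<lambda>((a, b), c). {a, b, c}) ` ?T \<subseteq> triangles"
      proof
        fix \<sigma> assume "\<sigma> \<in> (\<lambda>((a, b), c). {a, b, c}) ` ?T"
        then obtain a b c where \<sigma>: "\<sigma> = {a, b, c}"
          and abc: "a \<in> colour_class i" "b \<in> neighbours j a" "c \<in> apexes K {a, b}"
          by auto
        have "c \<in> colour_class k" and K: "{a, b, c} \<in> K" using ap[OF abc] by auto
        then have "a \<noteq> b" "a \<noteq> c" "b \<noteq> c"
          using abc palette_distinct[OF p] by (auto simp: colour_class_def neighbours_def)
        then show "\<sigma> \<in> triangles" using K by (simp add: triangles_def \<sigma>)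
      qed
      show "triangles \<subseteq> (\<lambda>((a, b), c). {a, b, c}) ` ?T"
      proof
        fix \<sigma> assume \<sigma>: "\<sigma> \<in> triangles"
        obtain a b c where abc: "a \<in> colour_class i" "b \<in> colour_class j" "c \<in> colour_class k"
          "\<sigma> = {a, b, c}" using triangle_colours[OF p \<sigma>] .
        then have K: "{a, b, c} \<in> K" using \<sigma> by (simp add: triangles_def)
        then have b: "b \<in> neighbours j a" using abc subface(1)[OF K] by (simp add: neighbours_def)
        then have "((a, b), c) \<in> ?T" using abc K apexes_colour[OF p abc(1) b] by auto
        then show "\<sigma> \<in> (\<lambda>((a, b), c). {a, b, c}) ` ?T"
          using abc(4) by (intro image_eqI) auto
      qed
    qed
  qed
  then have "card triangles = card ?T" by (simp add: bij_betw_same_card)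
  also have "\<dots> = (\<Sum>e\<in>?E. 2)"
  proof (subst card_SigmaI)
    show "finite ?E" using finite_colour_class finite_neighbours by (intro finite_SigmaI)
    show "\<forall>e\<in>?E. finite (apexes K {fst e, snd e})" using finite_apexes[OF complex] by blast
    show "(\<Sum>e\<in>?E. card (apexes K {fst e, snd e})) = (\<Sum>e\<in>?E. 2)"
      by (rule sum.cong) (use card_apexes_neighbour[OF p] in auto)
  qed
  also have "\<dots> = 2 * (\<Sum>a\<in>colour_class i. card (neighbours j a))"
    using finite_colour_class finite_neighbours by simp
  finally show ?thesis .
qed

lemma card_vertices:
  assumes p: "palette i j k"
  shows "card {\<sigma> \<in> K. card \<sigma> = 1} = card (colour_class i) + card (colour_class j) + card (colour_class k)"
proof -
  let ?V = "colour_class i \<union> colour_class j \<union> colour_class k"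
  have "{\<sigma> \<in> K. card \<sigma> = 1} = (\<lambda>v. {v}) ` ?V"
    using colour_cases[OF p] by (auto simp: card_1_singleton_iff colour_class_def)
  then have "card {\<sigma> \<in> K. card \<sigma> = 1} = card ?V" by (simp add: card_image)
  also have "\<dots> = card (colour_class i \<union> colour_class j) + card (colour_class k)"
    using palette_distinct[OF p] finite_colour_class
    by (intro card_Un_disjoint) (auto simp: colour_class_def)
  also have "card (colour_class i \<union> colour_class j) = card (colour_class i) + card (colour_class j)"
    using palette_distinct[OF p] finite_colour_class
    by (intro card_Un_disjoint) (auto simp: colour_class_def)
  finally show ?thesis .
qed

text \<open>The two apexes of an edge with the colours \<open>j\<close> and \<open>k\<close> have the colour \<open>i\<close>.\<close>

lemma two_le_card_colour_class:
  assumes p: "palette i j k"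
  shows "2 \<le> card (colour_class i)"
proof -
  obtain v where "{v} \<in> K" using nonvoid by blast
  then obtain a where a: "a \<in> colour_class i" using closed_stars_cover[OF p] by blast
  have "{} \<in> link a" using a by (simp add: link_def colour_class_def)
  then obtain b c where "b \<in> neighbours j a" "c \<in> neighbours k a" "{a, b, c} \<in> K"
    using link_pure[OF p a] by metis
  then show ?thesis
    using apexes_opposite_edge[OF p a] card_mono finite_colour_class by metis
qed

end

section \<open>Lower bounds for the projective plane\<close>

text \<open>A balanced surface that is identified with the projective plane, so that subcomplexes can be tested
for sections of the double covering.\<close>

locale balanced_projective_plane = balanced_closed_surface +
  fixes h g
  assumes hom: "homeomorphism (body K) veronese_surface h g"
begin

lemma lift_on_subcomplex_Un:
  assumes L: "abstract_simplicial_complex L" "L \<subseteq> K" "lift_on (h ` body L)"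
    and M: "abstract_simplicial_complex M" "M \<subseteq> K" "lift_on (h ` body M)"
    and con: "connected (body (L \<inter> M))"
  shows "lift_on (h ` body (L \<union> M))"
proof -
  have "compact veronese_surface"
    unfolding veronese_surface_def by (intro compact_continuous_image continuous_on_veronese) simp
  then have closed: "closed (h ` body N)" if "abstract_simplicial_complex N" "N \<subseteq> K" for N
    using closedin_body_subcomplex[OF complex that] homeomorphism_imp_closed_map[OF hom]
    by (meson closedin_compact compact_imp_closed)
  have cont: "continuous_on (body K) h" and inj: "inj_on h (body K)"
    using hom by (auto simp: homeomorphism_def intro: inj_on_inverseI[of _ g])
  have "h ` body (L \<inter> M) = h ` body L \<inter> h ` body M"
    unfolding body_Int using inj_on_image_Int[OF inj] body_mono L(2) M(2) by metis
  moreover have "connected (h ` body (L \<inter> M))"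
  proof (rule connected_continuous_image[OF _ con])
    have "body (L \<inter> M) \<subseteq> body K" using L(2) by (intro body_mono) blast
    then show "continuous_on (body (L \<inter> M)) h" by (rule continuous_on_subset[OF cont])
  qed
  ultimately show ?thesis
    unfolding body_Un image_Un
    using lift_on_Un[OF L(3) M(3) closed[OF L(1,2)] closed[OF M(1,2)]] by simp
qed

text \<open>Otherwise the star of \<open>a\<close> could be glued to the others along its connected link, giving a section over the
whole projective plane.\<close>

lemma not_lift_on_other_stars:
  assumes p: "palette i j k" and a: "a \<in> colour_class i" and le3: "card (neighbours k a) \<le> 3"
    and ne: "colour_class i - {a} \<noteq> {}"
  shows "\<not> lift_on (h ` body (\<Union>a'\<in>colour_class i - {a}. closed_star K a'))"
proof
  let ?M = "\<Union>a'\<in>colour_class i - {a}. closed_star K a'"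
  assume lift: "lift_on (h ` body ?M)"
  have star: "abstract_simplicial_complex (closed_star K a')" if "a' \<in> colour_class i" for a'
    using that complex by (intro abstract_simplicial_complex_closed_star) (auto simp: colour_class_def)
  have M: "abstract_simplicial_complex ?M"
    using star ne finite_colour_class unfolding abstract_simplicial_complex_def by blast
  have "lift_on (h ` body (closed_star K a \<union> ?M))"
  proof (rule lift_on_subcomplex_Un[OF star[OF a] closed_star_subset[OF complex] _ M _ lift])
    show "lift_on (h ` body (closed_star K a))"
      using a by (intro lift_on_closed_star[OF complex _ hom]) (simp add: colour_class_def)
    show "?M \<subseteq> K" using closed_star_subset[OF complex] by blast
    show "connected (body (closed_star K a \<inter> ?M))"
      unfolding closed_star_Int_others[OF p a] by (rule connected_link[OF p a le3])
  qed
  also have "closed_star K a \<union> ?M = K"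
    using closed_stars_cover[OF p] a by blast
  also have "h ` body K = veronese_surface" using hom by (simp add: homeomorphism_def)
  finally show False using no_global_lift by blast
qed

text \<open>Both vertices are adjacent to all vertices of the other two colours, of which there are equally many,
say \<open>n\<close>. For \<open>n \<le> 3\<close> the section over one star would contradict the previous lemma, and for
\<open>n \<ge> 4\<close> the complex is large enough.\<close>

lemma two_vertices_of_a_colour:
  assumes p: "palette i j k" and two: "card (colour_class i) = 2"
  shows "9 \<le> card {\<sigma> \<in> K. card \<sigma> = 1} \<and> 16 \<le> card triangles"
proof -
  obtain a a' where aa: "colour_class i = {a, a'}" "a \<noteq> a'" using two by (auto simp: card_2_iff)
  then have a: "a \<in> colour_class i" "a' \<in> colour_class i" by auto
  have all: "neighbours m x = colour_class m"
    if m: "palette m n i" and x: "x \<in> colour_class i" for m n x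
  proof
    show "neighbours m x \<subseteq> colour_class m" by (auto simp: neighbours_def)
    show "colour_class m \<subseteq> neighbours m x"
    proof
      fix b assume b: "b \<in> colour_class m"
      have "2 \<le> card (neighbours i b)"
        using two_le_card_neighbours[OF palette_perm(1)[OF m] b] .
      then have "neighbours i b = colour_class i"
        using two finite_colour_class by (intro card_seteq) (auto simp: neighbours_def)
      then show "b \<in> neighbours m x" using x b by (auto simp: neighbours_def insert_commute)
    qed
  qed
  have pj: "palette j k i" and pk: "palette k j i" using palette_perm p by blast+
  define n where "n = card (colour_class k)"
  have n: "card (colour_class j) = n"
    using card_neighbours_eq[OF p a(1)] all[OF pj a(1)] all[OF pk a(1)] by (simp add: n_def)
  have "\<not> n \<le> 3"
  proof
    assume "n \<le> 3"
    then have "card (neighbours k a) \<le> 3" using all[OF pk a(1)] by (simp add: n_def)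
    then have "\<not> lift_on (h ` body (\<Union>a'\<in>colour_class i - {a}. closed_star K a'))"
      using aa by (intro not_lift_on_other_stars[OF p a(1)]) auto
    moreover have "colour_class i - {a} = {a'}" using aa by auto
    moreover have "lift_on (h ` body (closed_star K a'))"
      using a by (intro lift_on_closed_star[OF complex _ hom]) (simp add: colour_class_def)
    ultimately show False by simp
  qed
  moreover have "card {\<sigma> \<in> K. card \<sigma> = 1} = 2 + n + n"
    using card_vertices[OF p] two n by (simp add: n_def)
  moreover have "card triangles = 4 * n"
    using card_triangles[OF p] all[OF pj] n aa by simp
  ultimately show ?thesis by simp
qed

text \<open>With fewer triangles the degree sum of the three vertices of colour \<open>i\<close> is so small that two of them
have links of length four. The stars of these two meet in a connected graph, so that there is a
section over their union, which is the union of the stars other than that of the third vertex.\<close>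

lemma three_vertices_of_each_colour:
  assumes p: "palette i j k"
    and three: "card (colour_class i) = 3" "card (colour_class j) \<le> 3" "card (colour_class k) \<le> 3"
  shows "16 \<le> card triangles"
proof (rule ccontr)
  assume "\<not> ?thesis"
  then have le7: "(\<Sum>a\<in>colour_class i. card (neighbours j a)) \<le> 7"
    using card_triangles[OF p] by simp
  have deg: "2 \<le> card (neighbours j a)" if "a \<in> colour_class i" for a
    using two_le_card_neighbours[OF p that] .
  obtain x y z where xyz: "colour_class i = {x, y, z}" "x \<noteq> y" "x \<noteq> z" "y \<noteq> z"
    using three(1) by (auto simp: card_3_iff)
  then have "card (neighbours j x) + card (neighbours j y) + card (neighbours j z) \<le> 7"
    using le7 by simp
  moreover have "2 \<le> card (neighbours j x)" "2 \<le> card (neighbours j y)" "2 \<le> card (neighbours j z)"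
    using deg xyz by auto
  ultimately have "\<exists>u v w. colour_class i = {u, v, w} \<and> u \<noteq> v \<and> u \<noteq> w \<and> v \<noteq> w \<and>
      card (neighbours j u) = 2 \<and> card (neighbours j v) = 2"
  proof -
    assume *: "card (neighbours j x) + card (neighbours j y) + card (neighbours j z) \<le> 7"
      "2 \<le> card (neighbours j x)" "2 \<le> card (neighbours j y)" "2 \<le> card (neighbours j z)"
    \<comment> \<open>Three numbers that are at least 2 and have a sum of at most 7: two of them are equal to 2.\<close>
    consider "card (neighbours j x) = 2" "card (neighbours j y) = 2"
      | "card (neighbours j x) = 2" "card (neighbours j z) = 2"
      | "card (neighbours j y) = 2" "card (neighbours j z) = 2"
      using * by linarith
    moreover have "{x, y, z} = {x, z, y}" "{x, y, z} = {y, z, x}" by auto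
    ultimately show ?thesis using xyz by cases metis+
  qed
  then obtain u v w where uvw: "colour_class i = {u, v, w}" "u \<noteq> v" "u \<noteq> w" "v \<noteq> w"
    and two: "card (neighbours j u) = 2" "card (neighbours j v) = 2" by blast
  have mem: "u \<in> colour_class i" "v \<in> colour_class i" "w \<in> colour_class i" using uvw by auto
  have two': "card (neighbours k u) = 2" "card (neighbours k v) = 2"
    using two card_neighbours_eq[OF p] mem by auto
  have star: "abstract_simplicial_complex (closed_star K a)" "lift_on (h ` body (closed_star K a))"
    if "a \<in> colour_class i" for a
    using that abstract_simplicial_complex_closed_star[OF complex] lift_on_closed_star[OF complex _ hom]
    by (auto simp: colour_class_def)
  have "lift_on (h ` body (closed_star K u \<union> closed_star K v))"
    by (rule lift_on_subcomplex_Un[OF star(1) closed_star_subset[OF complex] star(2)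
          star(1) closed_star_subset[OF complex] star(2)
          connected_closed_star_Int[OF p _ _ uvw(2) three(2,3) two']]) (rule mem)+
  moreover have "(\<Union>a'\<in>colour_class i - {w}. closed_star K a') = closed_star K u \<union> closed_star K v"
    using uvw by auto
  moreover have "card (neighbours k w) \<le> 3"
    using three(3) card_mono[OF finite_colour_class, of "neighbours k w" k]
    by (auto simp: neighbours_def)
  ultimately show False
    using not_lift_on_other_stars[OF p mem(3)] uvw by auto
qed

lemma face_number_bounds:
  "9 \<le> card {\<sigma> \<in> K. card \<sigma> = 1} \<and> 24 \<le> card edges \<and> 16 \<le> card triangles"
proof -
  have p: "palette 1 2 3" "palette 2 3 1" "palette 3 1 2" by (auto simp: palette_def)
  have "9 \<le> card {\<sigma> \<in> K. card \<sigma> = 1} \<and> 16 \<le> card triangles"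
  proof (cases "\<exists>i j k. palette i j k \<and> card (colour_class i) = 2")
    case True
    then show ?thesis using two_vertices_of_a_colour by blast
  next
    case False
    then have ge: "3 \<le> card (colour_class 1)" "3 \<le> card (colour_class 2)" "3 \<le> card (colour_class 3)"
      using p two_le_card_colour_class by (metis Suc_leI le_neq_implies_less numeral_2_eq_2 numeral_3_eq_3)+
    have "16 \<le> card triangles"
    proof (rule ccontr)
      assume few: "\<not> ?thesis"
      have le: "card (colour_class i) \<le> 3" if p: "palette i j k" for i j k
      proof -
        have "2 * card (colour_class i) \<le> (\<Sum>a\<in>colour_class i. card (neighbours j a))"
          using sum_mono[of "colour_class i" "\<lambda>_. 2" "\<lambda>a. card (neighbours j a)"]
            two_le_card_neighbours[OF p] by simp
        then show ?thesis using card_triangles[OF p] few by simp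
      qed
      show False
        using three_vertices_of_each_colour[OF p(1)] le p ge few by (meson le_antisym)
    qed
    moreover have "9 \<le> card {\<sigma> \<in> K. card \<sigma> = 1}"
      using card_vertices[OF p(1)] ge by simp
    ultimately show ?thesis by blast
  qed
  then show ?thesis using card_edges by linarith
qed

end

theorem balanced_projective_plane_bounds:
  assumes bal: "balanced K" and tri: "triangulation_of K real_projective_plane"
  shows "9 \<le> f_number 0 K \<and> 24 \<le> f_number 1 K \<and> 16 \<le> f_number 2 K"
proof -
  have K: "abstract_simplicial_complex K" using tri by (simp add: triangulation_of_def)
  have "geometric_realization K homeomorphic_space top_of_set veronese_surface"
    using tri real_projective_plane_homeomorphic_veronese_surface homeomorphic_space_trans
    unfolding triangulation_of_def by blast
  then have "top_of_set (body K) homeomorphic_space top_of_set veronese_surface"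
    by (simp add: geometric_realization_eq_body[OF K])
  then obtain h g where "homeomorphic_maps (top_of_set (body K)) (top_of_set veronese_surface) h g"
    unfolding homeomorphic_space_def by blast
  then have hg: "homeomorphism (body K) veronese_surface h g"
    unfolding homeomorphic_maps_def by (intro homeomorphismI) auto
  have X: "locally_planar (body K)" using hg by (rule locally_planar_homeomorphism)
  obtain \<kappa> :: "'a \<Rightarrow> nat" where \<kappa>: "\<kappa> \<in> vertices K \<rightarrow> {1, 2, 3}"
    "\<And>i j. i \<noteq> j \<Longrightarrow> {i, j} \<in> K \<Longrightarrow> \<kappa> i \<noteq> \<kappa> j"
    using bal unfolding balanced_def by (elim conjE exE) metis
  have "body K \<noteq> {}"
    using homeomorphism_image2[OF hg] by (auto simp: veronese_surface_def)
  then obtain x where x: "x \<in> body K" by blast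
  interpret balanced_projective_plane K \<kappa> h g
  proof
    show "\<exists>v. {v} \<in> K"
    proof -
      obtain v where "v \<in> support x" using support_nonempty[OF x] by blast
      moreover have "support x \<in> K" using x by (simp add: body_def)
      ultimately show ?thesis using abstract_simplicial_complexD(4)[OF K, of "support x" "{v}"] by auto
    qed
    show "\<kappa> v \<in> {1, 2, 3}" if "{v} \<in> K" for v
      using that \<kappa>(1) by (auto simp: vertices_def Pi_iff)
    show "card (apexes K {u, v}) = 2" if "u \<noteq> v" "{u, v} \<in> K" for u v
      using edge_has_two_apexes[OF K X that] edge_has_at_most_two_apexes[OF K X that(1)] by simp
    show "\<exists>v. v \<noteq> u \<and> {u, v} \<in> K" if "{u} \<in> K" for u
      using vertex_in_edge[OF K X that] .
  qed (use K \<kappa> hg in auto)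
  have "f_number i K = card {\<sigma> \<in> K. card \<sigma> = nat (i + 1)}" if "0 \<le> i" for i
    using that by (auto simp: f_number_def face_dim_def intro!: arg_cong[of _ _ card])
  then show ?thesis
    using face_number_bounds by (simp add: edges_def triangles_def numeral_2_eq_2[symmetric])
qed

section \<open>The face numbers of \<Delta>\<close>

fun colour :: "vertex \<Rightarrow> nat" where
  "colour a1 = 1" | "colour a2 = 1" | "colour a3 = 1"
| "colour b1 = 2" | "colour b2 = 2" | "colour b3 = 2"
| "colour c1 = 3" | "colour c2 = 3" | "colour c3 = 3"

text \<open>The facets with their vertices listed in the order of the colours, so that different triples are
different facets.\<close>

definition facet_triples :: "(vertex \<times> vertex \<times> vertex) set" where
  "facet_triples =
     {(a2, b2, c2), (a2, b3, c3), (a3, b2, c3), (a3, b3, c2),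
      (a1, b2, c2), (a1, b2, c3), (a1, b3, c2), (a1, b3, c3),
      (a2, b1, c2), (a2, b1, c3), (a3, b1, c2), (a3, b1, c3),
      (a2, b2, c1), (a2, b3, c1), (a3, b2, c1), (a3, b3, c1)}"

lemma facet_triples_colour:
  assumes "(x, y, z) \<in> facet_triples"
  shows "colour x = 1 \<and> colour y = 2 \<and> colour z = 3"
proof -
  have "\<forall>(x, y, z)\<in>facet_triples. colour x = 1 \<and> colour y = 2 \<and> colour z = 3"
    by (simp add: facet_triples_def)
  from bspec[OF this assms] show ?thesis by (simp only: prod.case)
qed

lemma \<Delta>_eq: "\<Delta> = {\<sigma>. \<exists>(x, y, z)\<in>facet_triples. \<sigma> \<subseteq> {x, y, z}}"
  unfolding \<Delta>_def complex_generated_by_def facet_triples_def by (simp only: bex_simps prod.case)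

lemma UNIV_vertex: "UNIV = {a1, a2, a3, b1, b2, b3, c1, c2, c3}"
  by (auto intro: vertex.exhaust)

lemma finite_vertex_set: "finite (A :: vertex set)"
  by (rule finite_subset[OF subset_UNIV]) (simp add: UNIV_vertex)

lemma complex_\<Delta>: "abstract_simplicial_complex \<Delta>"
  unfolding abstract_simplicial_complex_def
proof (intro conjI)
  have "finite (Pow (UNIV :: vertex set))" using finite_vertex_set[of UNIV] by (simp only: finite_Pow_iff)
  then show "finite \<Delta>" by (rule finite_subset[rotated]) auto
  show "{} \<in> \<Delta>" unfolding \<Delta>_eq by (auto simp: facet_triples_def)
  show "\<forall>\<sigma>\<in>\<Delta>. finite \<sigma>" using finite_vertex_set by blast
  show "\<forall>\<sigma>\<in>\<Delta>. \<forall>\<tau>. \<tau> \<subseteq> \<sigma> \<longrightarrow> \<tau> \<in> \<Delta>" unfolding \<Delta>_eq by blast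
qed

lemma card_facet:
  assumes "(x, y, z) \<in> facet_triples"
  shows "card {x, y, z} = 3"
proof -
  have "x \<noteq> y" "x \<noteq> z" "y \<noteq> z" using facet_triples_colour[OF assms] by auto
  then show ?thesis by simp
qed

lemma card_face_\<Delta>_le:
  assumes "\<sigma> \<in> \<Delta>"
  shows "card \<sigma> \<le> 3"
proof -
  obtain x y z where t: "(x, y, z) \<in> facet_triples" "\<sigma> \<subseteq> {x, y, z}"
    using assms unfolding \<Delta>_eq by auto
  have "card \<sigma> \<le> card {x, y, z}" by (rule card_mono[OF _ t(2)]) simp
  then show ?thesis using card_facet[OF t(1)] by simp
qed

lemma triangles_\<Delta>: "{\<sigma> \<in> \<Delta>. card \<sigma> = 3} = (\<lambda>(x, y, z). {x, y, z}) ` facet_triples"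
proof
  show "{\<sigma> \<in> \<Delta>. card \<sigma> = 3} \<subseteq> (\<lambda>(x, y, z). {x, y, z}) ` facet_triples"
  proof
    fix \<sigma> assume \<sigma>: "\<sigma> \<in> {\<sigma> \<in> \<Delta>. card \<sigma> = 3}"
    then obtain x y z where t: "(x, y, z) \<in> facet_triples" "\<sigma> \<subseteq> {x, y, z}" unfolding \<Delta>_eq by auto
    then have "\<sigma> = {x, y, z}"
      using \<sigma> card_facet[OF t(1)] by (intro card_subset_eq) auto
    then show "\<sigma> \<in> (\<lambda>(x, y, z). {x, y, z}) ` facet_triples" using t(1) by (intro image_eqI) auto
  qed
  show "(\<lambda>(x, y, z). {x, y, z}) ` facet_triples \<subseteq> {\<sigma> \<in> \<Delta>. card \<sigma> = 3}"
  proof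
    fix \<sigma> assume "\<sigma> \<in> (\<lambda>(x, y, z). {x, y, z}) ` facet_triples"
    then obtain x y z where "(x, y, z) \<in> facet_triples" "\<sigma> = {x, y, z}" by auto
    then show "\<sigma> \<in> {\<sigma> \<in> \<Delta>. card \<sigma> = 3}" using card_facet unfolding \<Delta>_eq by blast
  qed
qed

lemma card_triangles_\<Delta>: "card {\<sigma> \<in> \<Delta>. card \<sigma> = 3} = 16"
proof -
  have "inj_on (\<lambda>(x, y, z). {x, y, z}) facet_triples"
  proof (rule inj_onI)
    fix t t' assume tt: "t \<in> facet_triples" "t' \<in> facet_triples"
      and eq: "(\<lambda>(x, y, z). {x, y, z}) t = (\<lambda>(x, y, z). {x, y, z}) t'"
    obtain x y z x' y' z' where t: "t = (x, y, z)" "t' = (x', y', z')" by (metis prod.exhaust)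
    have col: "colour x = 1" "colour y = 2" "colour z = 3" "colour x' = 1" "colour y' = 2" "colour z' = 3"
      using facet_triples_colour tt unfolding t by blast+
    have "x \<in> {x', y', z'}" "y \<in> {x', y', z'}" "z \<in> {x', y', z'}" using eq unfolding t by auto
    then have "x = x'" "y = y'" "z = z'" using col by auto
    then show "t = t'" using t by simp
  qed
  moreover have "card facet_triples = 16" by (simp add: facet_triples_def)
  ultimately show ?thesis unfolding triangles_\<Delta> by (simp add: card_image)
qed

lemma two_element_subsets:
  assumes "\<sigma> \<subseteq> {x, y, z}" "card \<sigma> = 2"
  shows "\<sigma> = {x, y} \<or> \<sigma> = {x, z} \<or> \<sigma> = {y, z}"
proof -
  obtain u v where "\<sigma> = {u, v}" "u \<noteq> v" using assms(2) by (auto simp: card_2_iff)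
  with assms(1) show ?thesis by (auto simp: doubleton_eq_iff)
qed

definition edge_pairs :: "(vertex \<times> vertex) set" where
  "edge_pairs =
     {(a1, b2), (a1, b3), (a2, b1), (a2, b2), (a2, b3), (a3, b1), (a3, b2), (a3, b3),
      (a1, c2), (a1, c3), (a2, c1), (a2, c2), (a2, c3), (a3, c1), (a3, c2), (a3, c3),
      (b1, c2), (b1, c3), (b2, c1), (b2, c2), (b2, c3), (b3, c1), (b3, c2), (b3, c3)}"

lemma edge_pairs_facets:
  assumes "(x, y, z) \<in> facet_triples"
  shows "(x, y) \<in> edge_pairs \<and> (x, z) \<in> edge_pairs \<and> (y, z) \<in> edge_pairs"
proof -
  have "\<forall>(x, y, z)\<in>facet_triples. (x, y) \<in> edge_pairs \<and> (x, z) \<in> edge_pairs \<and> (y, z) \<in> edge_pairs"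
    by (simp add: facet_triples_def edge_pairs_def)
  from bspec[OF this assms] show ?thesis by (simp only: prod.case)
qed

lemma edge_pairs_colour:
  assumes "(u, v) \<in> edge_pairs"
  shows "colour u < colour v"
proof -
  have "\<forall>(u, v)\<in>edge_pairs. colour u < colour v" by (simp add: edge_pairs_def)
  from bspec[OF this assms] show ?thesis by (simp only: prod.case)
qed

lemma edge_pair_in_facet:
  assumes "(u, v) \<in> edge_pairs"
  shows "\<exists>(x, y, z)\<in>facet_triples. {u, v} \<subseteq> {x, y, z}"
proof -
  have "\<forall>(u, v)\<in>edge_pairs. \<exists>(x, y, z)\<in>facet_triples. {u, v} \<subseteq> {x, y, z}"
    by (simp add: edge_pairs_def facet_triples_def)
  from bspec[OF this assms] show ?thesis by (simp only: prod.case)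
qed

lemma edges_\<Delta>: "{\<sigma> \<in> \<Delta>. card \<sigma> = 2} = (\<lambda>(u, v). {u, v}) ` edge_pairs"
proof
  show "{\<sigma> \<in> \<Delta>. card \<sigma> = 2} \<subseteq> (\<lambda>(u, v). {u, v}) ` edge_pairs"
  proof
    fix \<sigma> assume \<sigma>: "\<sigma> \<in> {\<sigma> \<in> \<Delta>. card \<sigma> = 2}"
    then obtain x y z where t: "(x, y, z) \<in> facet_triples" "\<sigma> \<subseteq> {x, y, z}" unfolding \<Delta>_eq by auto
    have "card \<sigma> = 2" using \<sigma> by simp
    then obtain u v where "(u, v) \<in> edge_pairs" "\<sigma> = {u, v}"
      using two_element_subsets[OF t(2)] edge_pairs_facets[OF t(1)] by metis
    then show "\<sigma> \<in> (\<lambda>(u, v). {u, v}) ` edge_pairs" by (intro image_eqI) auto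
  qed
  show "(\<lambda>(u, v). {u, v}) ` edge_pairs \<subseteq> {\<sigma> \<in> \<Delta>. card \<sigma> = 2}"
  proof
    fix \<sigma> assume "\<sigma> \<in> (\<lambda>(u, v). {u, v}) ` edge_pairs"
    then obtain u v where uv: "(u, v) \<in> edge_pairs" "\<sigma> = {u, v}" by auto
    then have "\<sigma> \<in> \<Delta>" using edge_pair_in_facet[OF uv(1)] unfolding \<Delta>_eq by simp
    moreover have "u \<noteq> v" using edge_pairs_colour[OF uv(1)] by auto
    ultimately show "\<sigma> \<in> {\<sigma> \<in> \<Delta>. card \<sigma> = 2}" using uv(2) by simp
  qed
qed

lemma card_edges_\<Delta>: "card {\<sigma> \<in> \<Delta>. card \<sigma> = 2} = 24"
proof -
  have "inj_on (\<lambda>(u, v). {u, v}) edge_pairs"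
  proof (rule inj_onI)
    fix t t' assume tt: "t \<in> edge_pairs" "t' \<in> edge_pairs"
      and eq: "(\<lambda>(u, v). {u, v}) t = (\<lambda>(u, v). {u, v}) t'"
    obtain u v u' v' where t: "t = (u, v)" "t' = (u', v')" by (metis prod.exhaust)
    have "colour u < colour v" "colour u' < colour v'" using edge_pairs_colour tt unfolding t by blast+
    then show "t = t'" using eq unfolding t by (auto simp: doubleton_eq_iff)
  qed
  moreover have "card edge_pairs = 24" by (simp add: edge_pairs_def)
  ultimately show ?thesis unfolding edges_\<Delta> by (simp add: card_image)
qed

lemma singleton_in_\<Delta>: "{v} \<in> \<Delta>"
  by (cases v) (auto simp: \<Delta>_eq facet_triples_def)

lemma card_vertices_\<Delta>: "card {\<sigma> \<in> \<Delta>. card \<sigma> = 1} = 9"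
proof -
  have "{\<sigma> \<in> \<Delta>. card \<sigma> = 1} = (\<lambda>v. {v}) ` UNIV"
    using singleton_in_\<Delta> by (auto simp: card_1_singleton_iff)
  then have "card {\<sigma> \<in> \<Delta>. card \<sigma> = 1} = card (UNIV :: vertex set)" by (simp add: card_image)
  then show ?thesis by (simp add: UNIV_vertex)
qed

lemma f_number_eq_card: "0 \<le> i + 1 \<Longrightarrow> f_number i K = card {\<sigma> \<in> K. card \<sigma> = nat (i + 1)}"
  by (auto simp: f_number_def face_dim_def intro!: arg_cong[of _ _ card])

lemma f_numbers_\<Delta>:
  "f_number (- 1) \<Delta> = 1" "f_number 0 \<Delta> = 9" "f_number 1 \<Delta> = 24" "f_number 2 \<Delta> = 16"
proof -
  have "{} \<in> \<Delta>" using complex_\<Delta> by (simp only: abstract_simplicial_complex_def)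
  then have "{\<sigma> \<in> \<Delta>. card \<sigma> = 0} = {{}}"
    using finite_vertex_set by (auto simp only: card_eq_0_iff)
  then show "f_number (- 1) \<Delta> = 1" by (simp add: f_number_eq_card del: card_eq_0_iff)
  show "f_number 0 \<Delta> = 9" using card_vertices_\<Delta> by (simp add: f_number_eq_card)
  show "f_number 1 \<Delta> = 24" using card_edges_\<Delta> by (simp add: f_number_eq_card)
  show "f_number 2 \<Delta> = 16" using card_triangles_\<Delta> by (simp add: f_number_eq_card)
qed

lemma complex_dim_\<Delta>: "complex_dim \<Delta> = 2"
  unfolding complex_dim_def
proof (rule Max_eqI)
  show "finite (face_dim ` \<Delta>)" using complex_\<Delta> by (simp add: abstract_simplicial_complex_def)
  show "d \<le> 2" if "d \<in> face_dim ` \<Delta>" for d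
    using that card_face_\<Delta>_le by (force simp: face_dim_def)
  have "{a2, b2, c2} \<in> \<Delta>" by (auto simp: \<Delta>_eq facet_triples_def)
  then show "2 \<in> face_dim ` \<Delta>" by (rule rev_image_eqI) (simp add: face_dim_def)
qed

lemma balanced_\<Delta>: "balanced \<Delta>"
  unfolding balanced_def
proof (intro conjI exI[of _ colour] allI impI)
  show "colour \<in> vertices \<Delta> \<rightarrow> {1, 2, 3}"
  proof
    fix v show "colour v \<in> {1, 2, 3}" by (cases v) auto
  qed
  fix i j assume "i \<noteq> j \<and> {i, j} \<in> \<Delta>"
  then have "{i, j} \<in> {\<sigma> \<in> \<Delta>. card \<sigma> = 2}" by simp
  then obtain u v where "(u, v) \<in> edge_pairs" "{i, j} = {u, v}" unfolding edges_\<Delta> by auto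
  then show "colour i \<noteq> colour j" using edge_pairs_colour[of u v] by (auto simp: doubleton_eq_iff)
qed (rule complex_dim_\<Delta>)

section \<open>Barycentric coordinates on the subdivided octahedron\<close>

text \<open>For \<open>t \<ge> 0\<close> this is \<open>min (2 * min \<bar>x\<bar> \<bar>y\<bar>) t\<close> if \<open>x\<close> and \<open>y\<close> have the same sign, and \<open>0\<close>
otherwise. The present form shows that it is continuous across the sign change.\<close>

definition overlap :: "real \<Rightarrow> real \<Rightarrow> real \<Rightarrow> real" where
  "overlap x y t = max 0 (min (\<bar>x + y\<bar> - \<bar>x - y\<bar>) t)"

lemma overlap_nonneg: "0 \<le> overlap x y t"
  by (simp add: overlap_def)

lemma overlap_pos_iff: "0 < overlap x y t \<longleftrightarrow> 0 < x * y \<and> 0 < t"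
proof -
  have "\<bar>x + y\<bar> > \<bar>x - y\<bar> \<longleftrightarrow> 0 < x * y"
    by (auto simp: abs_if zero_less_mult_iff)
  then show ?thesis by (auto simp: overlap_def)
qed

lemma overlap_minus_pos_iff: "0 < overlap x (- y) t \<longleftrightarrow> x * y < 0 \<and> 0 < t"
  by (simp add: overlap_pos_iff)

lemma overlap_sum: "overlap x y t + overlap x (- y) t = max 0 (min (2 * min \<bar>x\<bar> \<bar>y\<bar>) t)"
  unfolding overlap_def by (auto simp: abs_if max_def min_def)

text \<open>On the octahedron \<open>\<bar>x\<bar> + \<bar>y\<bar> + \<bar>z\<bar> = 1\<close> these are the barycentric coordinates with respect to
the subdivision by the midpoints of the edges. The corners \<open>\<plusminus> e\<^sub>1\<close>, \<open>\<plusminus> e\<^sub>2\<close>, \<open>\<plusminus> e\<^sub>3\<close> carry the labels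
\<open>a1\<close>, \<open>b1\<close>, \<open>c1\<close>. The midpoints between the second and third axis carry \<open>a2\<close> where \<open>y\<close> and \<open>z\<close> have
equal signs and \<open>a3\<close> where the signs differ, and similarly for \<open>b\<close> and \<open>c\<close>. The functions are
even and homogeneous, so that they can be evaluated without normalization.\<close>

fun weight :: "real \<times> real \<times> real \<Rightarrow> vertex \<Rightarrow> real" where
  "weight (x, y, z) a1 = max 0 (\<bar>x\<bar> - \<bar>y\<bar> - \<bar>z\<bar>)"
| "weight (x, y, z) b1 = max 0 (\<bar>y\<bar> - \<bar>x\<bar> - \<bar>z\<bar>)"
| "weight (x, y, z) c1 = max 0 (\<bar>z\<bar> - \<bar>x\<bar> - \<bar>y\<bar>)"
| "weight (x, y, z) a2 = overlap y z (\<bar>y\<bar> + \<bar>z\<bar> - \<bar>x\<bar>)"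
| "weight (x, y, z) a3 = overlap y (- z) (\<bar>y\<bar> + \<bar>z\<bar> - \<bar>x\<bar>)"
| "weight (x, y, z) b2 = overlap x z (\<bar>x\<bar> + \<bar>z\<bar> - \<bar>y\<bar>)"
| "weight (x, y, z) b3 = overlap x (- z) (\<bar>x\<bar> + \<bar>z\<bar> - \<bar>y\<bar>)"
| "weight (x, y, z) c2 = overlap x y (\<bar>x\<bar> + \<bar>y\<bar> - \<bar>z\<bar>)"
| "weight (x, y, z) c3 = overlap x (- y) (\<bar>x\<bar> + \<bar>y\<bar> - \<bar>z\<bar>)"

lemma weight_nonneg: "0 \<le> weight u v"
  by (cases u; cases v) (auto simp: overlap_nonneg)

text \<open>A point is the combination of corners and edge midpoints with its barycentric coordinates as
coefficients; each midpoint contributes one half to each of its two coordinates.\<close>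

lemma abs_coordinates_of_weight:
  fixes x y z :: real
  defines "w \<equiv> weight (x, y, z)"
  shows "\<bar>x\<bar> = w a1 + ((w b2 + w b3) + (w c2 + w c3)) / 2"
    "\<bar>y\<bar> = w b1 + ((w a2 + w a3) + (w c2 + w c3)) / 2"
    "\<bar>z\<bar> = w c1 + ((w a2 + w a3) + (w b2 + w b3)) / 2"
proof -
  have pair: "w a2 + w a3 = max 0 (min (2 * min \<bar>y\<bar> \<bar>z\<bar>) (\<bar>y\<bar> + \<bar>z\<bar> - \<bar>x\<bar>))"
    "w b2 + w b3 = max 0 (min (2 * min \<bar>x\<bar> \<bar>z\<bar>) (\<bar>x\<bar> + \<bar>z\<bar> - \<bar>y\<bar>))"
    "w c2 + w c3 = max 0 (min (2 * min \<bar>x\<bar> \<bar>y\<bar>) (\<bar>x\<bar> + \<bar>y\<bar> - \<bar>z\<bar>))"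
    unfolding w_def weight.simps overlap_sum by (rule refl)+
  have single: "w a1 = max 0 (\<bar>x\<bar> - \<bar>y\<bar> - \<bar>z\<bar>)" "w b1 = max 0 (\<bar>y\<bar> - \<bar>x\<bar> - \<bar>z\<bar>)"
    "w c1 = max 0 (\<bar>z\<bar> - \<bar>x\<bar> - \<bar>y\<bar>)"
    unfolding w_def weight.simps by (rule refl)+
  have gen: "p = max 0 (p - q - r) + (max 0 (min (2 * min p r) (p + r - q)) + max 0 (min (2 * min p q) (p + q - r))) / 2"
    "p = max 0 (p - q - r) + (max 0 (min (2 * min p r) (p + r - q)) + max 0 (min (2 * min q p) (q + p - r))) / 2"
    "p = max 0 (p - q - r) + (max 0 (min (2 * min r p) (r + p - q)) + max 0 (min (2 * min q p) (q + p - r))) / 2"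
    if "0 \<le> p" "0 \<le> q" "0 \<le> r" for p q r :: real
    using that by (auto simp: max_def min_def field_simps)
  show "\<bar>x\<bar> = w a1 + ((w b2 + w b3) + (w c2 + w c3)) / 2"
    unfolding pair single by (rule gen(1)) (rule abs_ge_zero)+
  show "\<bar>y\<bar> = w b1 + ((w a2 + w a3) + (w c2 + w c3)) / 2"
    unfolding pair single by (rule gen(2)) (rule abs_ge_zero)+
  show "\<bar>z\<bar> = w c1 + ((w a2 + w a3) + (w b2 + w b3)) / 2"
    unfolding pair single by (rule gen(3)) (rule abs_ge_zero)+
qed

lemma sum_weight: "sum (weight (x, y, z)) UNIV = \<bar>x\<bar> + \<bar>y\<bar> + \<bar>z\<bar>"
proof -
  let ?w = "weight (x, y, z)"
  have "sum ?w UNIV = ?w a1 + (?w a2 + (?w a3 + (?w b1 + (?w b2 + (?w b3 + (?w c1 + (?w c2 + ?w c3)))))))"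
    unfolding UNIV_vertex by (simp del: weight.simps)
  also have "\<dots> = (?w a1 + ((?w b2 + ?w b3) + (?w c2 + ?w c3)) / 2) +
      (?w b1 + ((?w a2 + ?w a3) + (?w c2 + ?w c3)) / 2) + (?w c1 + ((?w a2 + ?w a3) + (?w b2 + ?w b3)) / 2)"
    by (simp add: field_simps del: weight.simps)
  also have "\<dots> = \<bar>x\<bar> + \<bar>y\<bar> + \<bar>z\<bar>"
    by (simp only: abs_coordinates_of_weight[symmetric])
  finally show ?thesis .
qed

text \<open>The sign of \<open>x * y\<close> can be read off from the overlaps of \<open>x\<close> and \<open>y\<close>, unless \<open>z\<close> dominates. In the
latter case the signs of \<open>x * z\<close> and \<open>y * z\<close> can be read off, and they determine that of \<open>x * y\<close>.\<close>

lemma product_of_overlaps: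
  fixes x y z x' y' z' :: real
  assumes abs: "\<bar>x'\<bar> = \<bar>x\<bar>" "\<bar>y'\<bar> = \<bar>y\<bar>" "\<bar>z'\<bar> = \<bar>z\<bar>"
    and xy: "overlap x' y' (\<bar>x\<bar> + \<bar>y\<bar> - \<bar>z\<bar>) = overlap x y (\<bar>x\<bar> + \<bar>y\<bar> - \<bar>z\<bar>)"
      "overlap x' (- y') (\<bar>x\<bar> + \<bar>y\<bar> - \<bar>z\<bar>) = overlap x (- y) (\<bar>x\<bar> + \<bar>y\<bar> - \<bar>z\<bar>)"
    and xz: "overlap x' z' (\<bar>x\<bar> + \<bar>z\<bar> - \<bar>y\<bar>) = overlap x z (\<bar>x\<bar> + \<bar>z\<bar> - \<bar>y\<bar>)"
      "overlap x' (- z') (\<bar>x\<bar> + \<bar>z\<bar> - \<bar>y\<bar>) = overlap x (- z) (\<bar>x\<bar> + \<bar>z\<bar> - \<bar>y\<bar>)"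
    and yz: "overlap y' z' (\<bar>y\<bar> + \<bar>z\<bar> - \<bar>x\<bar>) = overlap y z (\<bar>y\<bar> + \<bar>z\<bar> - \<bar>x\<bar>)"
      "overlap y' (- z') (\<bar>y\<bar> + \<bar>z\<bar> - \<bar>x\<bar>) = overlap y (- z) (\<bar>y\<bar> + \<bar>z\<bar> - \<bar>x\<bar>)"
  shows "x' * y' = x * y"
proof -
  have same: "a' * b' = a * b"
    if "\<bar>a'\<bar> = \<bar>a\<bar>" "\<bar>b'\<bar> = \<bar>b\<bar>" "0 < t" "overlap a' b' t = overlap a b t"
      "overlap a' (- b') t = overlap a (- b) t" for a b a' b' t :: real
  proof -
    have "0 < a' * b' \<longleftrightarrow> 0 < a * b" "a' * b' < 0 \<longleftrightarrow> a * b < 0"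
      using that overlap_pos_iff overlap_minus_pos_iff by metis+
    moreover have "\<bar>a' * b'\<bar> = \<bar>a * b\<bar>" using that by (simp add: abs_mult)
    ultimately show ?thesis by linarith
  qed
  show ?thesis
  proof (cases "0 < \<bar>x\<bar> + \<bar>y\<bar> - \<bar>z\<bar>")
    case True
    then show ?thesis using same[OF abs(1,2) _ xy] by simp
  next
    case far: False
    show ?thesis
    proof (cases "x = 0 \<or> y = 0")
      case True
      then show ?thesis using abs by auto
    next
      case False
      then have "0 < \<bar>x\<bar> + \<bar>z\<bar> - \<bar>y\<bar>" "0 < \<bar>y\<bar> + \<bar>z\<bar> - \<bar>x\<bar>" using far by linarith+
      then have "x' * z' = x * z" "y' * z' = y * z"
        using same[OF abs(1,3) _ xz] same[OF abs(2,3) _ yz] by blast+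
      then have "(x' * z') * (y' * z') = (x * z) * (y * z)" by simp
      then have "x' * y' * (z' * z') = x * y * (z * z)" by (simp add: mult_ac)
      moreover have "z' * z' = z * z" using abs(3) by (metis abs_mult_self_eq)
      moreover have "z \<noteq> 0" using False far by auto
      ultimately show ?thesis by simp
    qed
  qed
qed

text \<open>A point is determined by its weights up to sign; the products of its coordinates are what is
compared in \<open>veronese\<close>.\<close>

lemma products_of_weight:
  assumes "weight (x', y', z') = weight (x, y, z)"
  shows "x' * x' = x * x" "y' * y' = y * y" "z' * z' = z * z"
    "x' * y' = x * y" "x' * z' = x * z" "y' * z' = y * z"
proof -
  have abs: "\<bar>x'\<bar> = \<bar>x\<bar>" "\<bar>y'\<bar> = \<bar>y\<bar>" "\<bar>z'\<bar> = \<bar>z\<bar>"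
    by (simp_all only: abs_coordinates_of_weight[where x=x' and y=y' and z=z']
        abs_coordinates_of_weight[where x=x and y=y and z=z] assms)
  then show "x' * x' = x * x" "y' * y' = y * y" "z' * z' = z * z" by (metis abs_mult_self_eq)+
  note w = fun_cong[OF assms]
  note xy = w[of c2, unfolded weight.simps abs] w[of c3, unfolded weight.simps abs]
  note xz = w[of b2, unfolded weight.simps abs] w[of b3, unfolded weight.simps abs]
  note yz = w[of a2, unfolded weight.simps abs] w[of a3, unfolded weight.simps abs]
  show "x' * y' = x * y" by (rule product_of_overlaps[OF abs xy xz yz])
  have swap: "overlap b a (q + p - r) = overlap a b (p + q - r)"
    "overlap b (- a) (q + p - r) = overlap a (- b) (p + q - r)" for a b p q r
    by (simp_all add: overlap_def abs_minus_commute add.commute)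
  show "x' * z' = x * z"
    by (rule product_of_overlaps[OF abs(1,3,2) xz xy]) (simp_all only: swap[where a=y] swap[where a=y'] yz)
  show "y' * z' = y * z"
    by (rule product_of_overlaps[OF abs(2,3,1) yz])
      (simp_all only: swap[where a=x] swap[where a=x'] xy xz)
qed

lemma weight_minus: "weight (- x, - y, - z) v = weight (x, y, z) v"
proof -
  have "overlap (- a) (- b) t = overlap a b t" for a b t
    using abs_minus_cancel[of "a + b"] by (simp add: overlap_def abs_minus_commute)
  then show ?thesis by (cases v) (simp_all only: weight.simps abs_minus_cancel)
qed

lemma weight_scale:
  assumes r: "0 \<le> r"
  shows "weight (r * x, r * y, r * z) v = r * weight (x, y, z) v"
proof -
  have mx: "max 0 (r * t) = r * max 0 t" and mn: "min (r * s) (r * t) = r * min s t" for s t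
    using r by (auto simp: max_def min_def mult_le_cancel_left zero_le_mult_iff)
  have abs: "\<bar>r * a\<bar> = r * \<bar>a\<bar>" for a using r by (simp add: abs_mult)
  have ov: "overlap (r * a) (r * b) (r * t) = r * overlap a b t" for a b t
    unfolding overlap_def distrib_left[symmetric] right_diff_distrib[symmetric] abs mx mn
    by (rule refl)
  have neg: "- (r * a) = r * (- a)" for a by simp
  show ?thesis
    by (cases v; simp only: weight.simps abs neg ov mx
        distrib_left[symmetric] right_diff_distrib[symmetric])
qed

lemma overlap_nonpos: "t \<le> 0 \<Longrightarrow> overlap a b t = 0"
  by (simp add: overlap_def max_absorb1 min.coboundedI2)

text \<open>If one coordinate dominates, the point lies in a triangle at the corresponding corner. Otherwise it
lies in the triangle of the three edge midpoints of its octant; the product of the three signs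
\<open>sgn (y * z)\<close>, \<open>sgn (x * z)\<close>, \<open>sgn (x * y)\<close> is 1, which leaves the four facets without \<open>a1\<close>, \<open>b1\<close>, \<open>c1\<close>.\<close>

lemma support_weight: "support (weight (x, y, z)) \<in> \<Delta>"
proof -
  let ?w = "weight (x, y, z)"
  have ov: "overlap p (- q) t = 0" if "0 \<le> p * q" for p q t
    using that overlap_minus_pos_iff[of p q t] overlap_nonneg[of p "- q" t] by linarith
  have ov': "overlap p q t = 0" if "\<not> 0 \<le> p * q" for p q t
    using that overlap_pos_iff[of p q t] overlap_nonneg[of p q t] by linarith
  define A B C where "A = (if 0 \<le> y * z then a2 else a3)" and "B = (if 0 \<le> x * z then b2 else b3)"
    and "C = (if 0 \<le> x * y then c2 else c3)"
  have A: "A = a2 \<and> ?w a3 = 0 \<or> A = a3 \<and> ?w a2 = 0"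
    by (cases "0 \<le> y * z") (simp_all add: A_def ov ov')
  have B: "B = b2 \<and> ?w b3 = 0 \<or> B = b3 \<and> ?w b2 = 0"
    by (cases "0 \<le> x * z") (simp_all add: B_def ov ov')
  have C: "C = c2 \<and> ?w c3 = 0 \<or> C = c3 \<and> ?w c2 = 0"
    by (cases "0 \<le> x * y") (simp_all add: C_def ov ov')
  have inF: "support ?w \<in> \<Delta>" if "(p, q, r) \<in> facet_triples" "\<And>v. v \<notin> {p, q, r} \<Longrightarrow> ?w v = 0" for p q r
  proof -
    have "support ?w \<subseteq> {p, q, r}" using that(2) by blast
    then show ?thesis unfolding \<Delta>_eq using that(1) by auto
  qed
  have zero_a: "?w a2 = 0" "?w a3 = 0" "?w b1 = 0" "?w c1 = 0" if "\<bar>y\<bar> + \<bar>z\<bar> \<le> \<bar>x\<bar>"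
    using that by (auto intro!: overlap_nonpos max_absorb1)
  have zero_b: "?w b2 = 0" "?w b3 = 0" "?w a1 = 0" "?w c1 = 0" if "\<bar>x\<bar> + \<bar>z\<bar> \<le> \<bar>y\<bar>"
    using that by (auto intro!: overlap_nonpos max_absorb1)
  have zero_c: "?w c2 = 0" "?w c3 = 0" "?w a1 = 0" "?w b1 = 0" if "\<bar>x\<bar> + \<bar>y\<bar> \<le> \<bar>z\<bar>"
    using that by (auto intro!: overlap_nonpos max_absorb1)
  consider (a) "\<bar>y\<bar> + \<bar>z\<bar> \<le> \<bar>x\<bar>" | (b) "\<bar>x\<bar> + \<bar>z\<bar> \<le> \<bar>y\<bar>" | (c) "\<bar>x\<bar> + \<bar>y\<bar> \<le> \<bar>z\<bar>"
    | (mid) "\<bar>x\<bar> < \<bar>y\<bar> + \<bar>z\<bar>" "\<bar>y\<bar> < \<bar>x\<bar> + \<bar>z\<bar>" "\<bar>z\<bar> < \<bar>x\<bar> + \<bar>y\<bar>"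
    by (meson not_le)
  then show ?thesis
  proof cases
    case a
    show ?thesis
    proof (rule inF)
      show "(a1, B, C) \<in> facet_triples"
        using B C by (auto simp: facet_triples_def)
      show "?w v = 0" if "v \<notin> {a1, B, C}" for v
        using that zero_a[OF a] B C by (cases v) (auto simp del: weight.simps)
    qed
  next
    case b
    show ?thesis
    proof (rule inF)
      show "(A, b1, C) \<in> facet_triples"
        using A C by (auto simp: facet_triples_def)
      show "?w v = 0" if "v \<notin> {A, b1, C}" for v
        using that zero_b[OF b] A C by (cases v) (auto simp del: weight.simps)
    qed
  next
    case c
    show ?thesis
    proof (rule inF)
      show "(A, B, c1) \<in> facet_triples"
        using A B by (auto simp: facet_triples_def)
      show "?w v = 0" if "v \<notin> {A, B, c1}" for v
        using that zero_c[OF c] A B by (cases v) (auto simp del: weight.simps)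
    qed
  next
    case mid
    show ?thesis
    proof (rule inF)
      have "x \<noteq> 0" "y \<noteq> 0" "z \<noteq> 0" using mid by auto
      then show "(A, B, C) \<in> facet_triples"
        by (cases "0 \<le> x"; cases "0 \<le> y"; cases "0 \<le> z")
          (simp_all add: A_def B_def C_def facet_triples_def zero_le_mult_iff)
      have "?w a1 = 0" "?w b1 = 0" "?w c1 = 0"
        using mid by (simp_all add: max_absorb1)
      then show "?w v = 0" if "v \<notin> {A, B, C}" for v
        using that A B C by (cases v) (auto simp del: weight.simps)
    qed
  qed
qed

text \<open>The symmetry of \<Delta> induced by the reflection \<open>y \<mapsto> - y\<close>.\<close>

fun flip_y :: "vertex \<Rightarrow> vertex" where
  "flip_y a2 = a3" | "flip_y a3 = a2" | "flip_y c2 = c3" | "flip_y c3 = c2" | "flip_y v = v"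

text \<open>The symmetry of \<Delta> induced by the reflection \<open>z \<mapsto> - z\<close>.\<close>

fun flip_z :: "vertex \<Rightarrow> vertex" where
  "flip_z a2 = a3" | "flip_z a3 = a2" | "flip_z b2 = b3" | "flip_z b3 = b2" | "flip_z v = v"

lemma flip_involution: "flip_y (flip_y v) = v" "flip_z (flip_z v) = v" "flip_y (flip_z v) = flip_z (flip_y v)"
  by (cases v; simp)+

lemma weight_flip:
  "weight (x, - y, z) v = weight (x, y, z) (flip_y v)"
  "weight (x, y, - z) v = weight (x, y, z) (flip_z v)"
proof -
  have ov: "overlap (- a) b t = overlap a (- b) t" for a b t
    using abs_minus_commute[of a b] abs_minus_cancel[of "a + b"] by (simp add: overlap_def)
  show "weight (x, - y, z) v = weight (x, y, z) (flip_y v)"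
    by (cases v) (simp_all only: weight.simps flip_y.simps abs_minus_cancel ov minus_minus)
  show "weight (x, y, - z) v = weight (x, y, z) (flip_z v)"
    by (cases v) (simp_all only: weight.simps flip_z.simps abs_minus_cancel minus_minus)
qed

text \<open>The four facets into which the positive octant is cut.\<close>

definition octant_triples :: "(vertex \<times> vertex \<times> vertex) set" where
  "octant_triples = {(a2, b2, c2), (a1, b2, c2), (a2, b1, c2), (a2, b2, c1)}"

lemma facet_flips_to_octant:
  assumes "(p, q, r) \<in> facet_triples"
  shows "\<exists>g\<in>{\<lambda>v. v, flip_y, flip_z, \<lambda>v. flip_y (flip_z v)}. (g p, g q, g r) \<in> octant_triples"
proof -
  have "\<forall>(p, q, r)\<in>facet_triples.
      \<exists>g\<in>{\<lambda>v. v, flip_y, flip_z, \<lambda>v. flip_y (flip_z v)}. (g p, g q, g r) \<in> octant_triples"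
    by (simp add: facet_triples_def octant_triples_def)
  from bspec[OF this assms] show ?thesis by (simp only: prod.case)
qed

lemma overlap_nonneg_args:
  assumes "0 \<le> x" "0 \<le> y"
  shows "overlap x y t = max 0 (min (2 * min x y) t)" "overlap x (- y) t = 0"
  using assms by (auto simp: overlap_def min_def max_def)

text \<open>On the positive octant the inverse of the barycentric coordinates is given by a single formula.\<close>

lemma weight_octant:
  assumes nonneg: "\<And>v. 0 \<le> x v" and F: "(p, q, r) \<in> octant_triples"
    and zero: "\<And>v. v \<notin> {p, q, r} \<Longrightarrow> x v = 0"
  shows "weight (x a1 + (x b2 + x c2) / 2, x b1 + (x a2 + x c2) / 2, x c1 + (x a2 + x b2) / 2) v = x v"
proof -
  define X Y Z where XYZ: "X = x a1 + (x b2 + x c2) / 2" "Y = x b1 + (x a2 + x c2) / 2"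
    "Z = x c1 + (x a2 + x b2) / 2"
  have pos: "0 \<le> X" "0 \<le> Y" "0 \<le> Z"
    using nonneg by (auto simp: XYZ intro!: add_nonneg_nonneg)
  have three: "x a3 = 0" "x b3 = 0" "x c3 = 0"
    using F zero by (auto simp: octant_triples_def)
  have one: "(x a1 = 0 \<and> x b1 = 0 \<and> x c1 = 0) \<or> (x a2 = 0 \<and> x b1 = 0 \<and> x c1 = 0) \<or>
      (x b2 = 0 \<and> x a1 = 0 \<and> x c1 = 0) \<or> (x c2 = 0 \<and> x a1 = 0 \<and> x b1 = 0)"
    using F zero by (auto simp: octant_triples_def)
  note nn = nonneg[of a1] nonneg[of a2] nonneg[of b1] nonneg[of b2] nonneg[of c1] nonneg[of c2]
  have ab: "\<bar>X\<bar> = X" "\<bar>Y\<bar> = Y" "\<bar>Z\<bar> = Z" using pos by simp_all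
  have "max 0 (X - Y - Z) = x a1" "max 0 (Y - X - Z) = x b1" "max 0 (Z - X - Y) = x c1"
    using one nn by (auto simp: XYZ max_def field_simps)
  moreover have "max 0 (min (2 * min Y Z) (Y + Z - X)) = x a2"
    using one nn by (elim disjE conjE) (auto simp: XYZ max_def min_def field_simps)
  moreover have "max 0 (min (2 * min X Z) (X + Z - Y)) = x b2"
    using one nn by (elim disjE conjE) (auto simp: XYZ max_def min_def field_simps)
  moreover have "max 0 (min (2 * min X Y) (X + Y - Z)) = x c2"
    using one nn by (elim disjE conjE) (auto simp: XYZ max_def min_def field_simps)
  ultimately show ?thesis
    unfolding XYZ[symmetric] using three
    by (cases v) (simp_all only: weight.simps ab overlap_nonneg_args pos)
qed

text \<open>By the reflections it suffices to reach the facets of the positive octant.\<close>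

lemma weight_surjective:
  assumes x: "x \<in> body \<Delta>"
  obtains u where "weight u = x"
proof -
  have "support x \<in> \<Delta>" and nonneg: "0 \<le> x v" for v using x by (auto simp: body_def)
  then obtain p q r where F: "(p, q, r) \<in> facet_triples" "support x \<subseteq> {p, q, r}"
    unfolding \<Delta>_eq by auto
  obtain g where g: "g \<in> {\<lambda>v. v, flip_y, flip_z, \<lambda>v. flip_y (flip_z v)}"
    "(g p, g q, g r) \<in> octant_triples"
    using facet_flips_to_octant[OF F(1)] by blast
  have gg: "g (g v) = v" for v using g(1) by (auto simp: flip_involution)
  obtain X Y Z where w: "\<And>v. weight (X, Y, Z) v = x (g v)"
  proof
    fix v
    show "weight (x (g a1) + (x (g b2) + x (g c2)) / 2, x (g b1) + (x (g a2) + x (g c2)) / 2,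
        x (g c1) + (x (g a2) + x (g b2)) / 2) v = x (g v)"
    proof (rule weight_octant[of "\<lambda>v. x (g v)", OF _ g(2)])
      show "x (g v) = 0" if "v \<notin> {g p, g q, g r}" for v
      proof -
        have "g v \<notin> {p, q, r}" using that gg[of v] by auto
        then show ?thesis using F(2) by auto
      qed
    qed (rule nonneg)
  qed
  have w': "weight (X, Y, Z) (g v) = x v" for v using w[of "g v"] gg by simp
  consider "g = (\<lambda>v. v)" | "g = flip_y" | "g = flip_z" | "g = (\<lambda>v. flip_y (flip_z v))"
    using g(1) by blast
  then show thesis
  proof cases
    case 1 show thesis by (rule that[of "(X, Y, Z)"]) (use w' 1 in auto)
  next
    case 2 show thesis by (rule that[of "(X, - Y, Z)"]) (use w' 2 in \<open>auto simp: weight_flip simp del: weight.simps\<close>)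
  next
    case 3 show thesis by (rule that[of "(X, Y, - Z)"]) (use w' 3 in \<open>auto simp: weight_flip simp del: weight.simps\<close>)
  next
    case 4 show thesis by (rule that[of "(X, - Y, - Z)"])
        (use w' 4 in \<open>auto simp: weight_flip flip_involution simp del: weight.simps\<close>)
  qed
qed

definition octahedral_norm :: "real^3 \<Rightarrow> real" where
  "octahedral_norm y = \<bar>y $ 1\<bar> + \<bar>y $ 2\<bar> + \<bar>y $ 3\<bar>"

text \<open>The radial projection of the sphere onto the octahedron, in barycentric coordinates.\<close>

definition octahedral_map :: "real^3 \<Rightarrow> vertex \<Rightarrow> real" where
  "octahedral_map y = (\<lambda>v. weight (y $ 1, y $ 2, y $ 3) v / octahedral_norm y)"

lemma octahedral_norm_pos: "y \<in> unit_sphere \<Longrightarrow> 0 < octahedral_norm y"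
proof -
  assume "y \<in> unit_sphere"
  then have "y \<noteq> 0" by auto
  then have "y $ 1 \<noteq> 0 \<or> y $ 2 \<noteq> 0 \<or> y $ 3 \<noteq> 0" by (auto simp: vec_eq_iff forall_3)
  then show ?thesis by (auto simp: octahedral_norm_def)
qed

lemma octahedral_map_in_body:
  assumes "y \<in> unit_sphere"
  shows "octahedral_map y \<in> body \<Delta>"
proof -
  have pos: "0 < octahedral_norm y" using assms by (rule octahedral_norm_pos)
  have "support (octahedral_map y) = support (weight (y $ 1, y $ 2, y $ 3))"
    using pos by (simp add: octahedral_map_def)
  then have "support (octahedral_map y) \<in> \<Delta>" using support_weight by simp
  moreover have "sum (octahedral_map y) UNIV = 1"
    using pos unfolding octahedral_map_def sum_divide_distrib[symmetric] sum_weight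
    by (simp add: octahedral_norm_def)
  moreover have "0 \<le> octahedral_map y v" for v
    using pos weight_nonneg by (simp add: octahedral_map_def)
  ultimately show ?thesis
    using sum_support[OF finite_vertex_set, of "octahedral_map y" UNIV] by (simp add: body_def)
qed

lemma continuous_on_octahedral_map: "continuous_on unit_sphere octahedral_map"
proof (rule continuous_on_coordinatewise_then_product)
  fix v
  have "continuous_on unit_sphere (\<lambda>y. weight (y $ 1, y $ 2, y $ 3) v)"
    by (cases v) (simp_all only: weight.simps overlap_def, (intro continuous_intros)+)
  moreover have "continuous_on unit_sphere octahedral_norm"
    unfolding octahedral_norm_def by (intro continuous_intros)
  ultimately show "continuous_on unit_sphere (\<lambda>y. octahedral_map y v)"
    unfolding octahedral_map_def using octahedral_norm_pos
    by (intro continuous_on_divide) force+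
qed

lemma octahedral_map_surjective: "octahedral_map ` unit_sphere = body \<Delta>"
proof
  show "octahedral_map ` unit_sphere \<subseteq> body \<Delta>" using octahedral_map_in_body by blast
  show "body \<Delta> \<subseteq> octahedral_map ` unit_sphere"
  proof
    fix x assume x: "x \<in> body \<Delta>"
    obtain X Y Z where w: "weight (X, Y, Z) = x" using weight_surjective[OF x] by (metis prod.exhaust)
    have one: "\<bar>X\<bar> + \<bar>Y\<bar> + \<bar>Z\<bar> = 1"
      using sum_weight[of X Y Z] body_sum[OF x finite_vertex_set[of UNIV]] w by simp
    define u :: "real^3" where "u = vector [X, Y, Z]"
    have u: "u $ 1 = X" "u $ 2 = Y" "u $ 3 = Z" by (simp_all add: u_def)
    have "u \<noteq> 0" using one u by (metis abs_zero add.right_neutral zero_index zero_neq_one)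
    define r where "r = inverse (norm u)"
    have r: "0 < r" using \<open>u \<noteq> 0\<close> by (simp add: r_def)
    define y where "y = r *\<^sub>R u"
    have y: "y $ 1 = r * X" "y $ 2 = r * Y" "y $ 3 = r * Z" by (simp_all add: y_def u)
    have "y \<in> unit_sphere" using \<open>u \<noteq> 0\<close> by (simp add: y_def r_def)
    moreover have "octahedral_norm y = r"
      using r one unfolding octahedral_norm_def y by (simp add: abs_mult distrib_left[symmetric])
    then have "octahedral_map y = x"
      using r w by (simp add: octahedral_map_def y weight_scale fun_eq_iff)
    ultimately show "x \<in> octahedral_map ` unit_sphere" by blast
  qed
qed

text \<open>Equal images mean that the weights are proportional, hence so are the matrices \<open>x x\<^sup>T\<close> and
\<open>y y\<^sup>T\<close>; both have trace 1.\<close>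

lemma octahedral_map_eq_iff:
  assumes x: "x \<in> unit_sphere" and y: "y \<in> unit_sphere"
  shows "octahedral_map x = octahedral_map y \<longleftrightarrow> veronese x = veronese y"
proof
  assume "veronese x = veronese y"
  then have "y = x \<or> y = - x" using x y by (simp add: veronese_eq_iff)
  then show "octahedral_map x = octahedral_map y"
    by (auto simp: octahedral_map_def octahedral_norm_def weight_minus simp del: weight.simps)
next
  assume eq: "octahedral_map x = octahedral_map y"
  have pos: "0 < octahedral_norm x" "0 < octahedral_norm y" using x y octahedral_norm_pos by auto
  define r where "r = octahedral_norm x / octahedral_norm y"
  have r: "0 < r" using pos by (simp add: r_def)
  have "weight (x $ 1, x $ 2, x $ 3) = weight (r * y $ 1, r * y $ 2, r * y $ 3)"
  proof
    fix v
    have "weight (x $ 1, x $ 2, x $ 3) v = r * weight (y $ 1, y $ 2, y $ 3) v"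
      using fun_cong[OF eq, of v] pos by (simp add: octahedral_map_def r_def field_simps)
    then show "weight (x $ 1, x $ 2, x $ 3) v = weight (r * y $ 1, r * y $ 2, r * y $ 3) v"
      using r by (simp add: weight_scale)
  qed
  note prods = products_of_weight[OF this]
  have "x \<bullet> x = (r * r) * (y \<bullet> y)"
    using prods(1-3) by (simp add: inner_vec_def sum_3 algebra_simps)
  then have r1: "r * r = 1" using x y by (simp add: dot_square_norm)
  have "x $ i * x $ j = y $ i * y $ j" for i j
  proof -
    have "x $ i * x $ j = (r * r) * (y $ i * y $ j)"
      using exhaust_3[of i] exhaust_3[of j] prods by (auto simp: mult_ac)
    then show ?thesis using r1 by simp
  qed
  then show "veronese x = veronese y" by (simp add: veronese_def vec_eq_iff)
qed

lemma triangulation_\<Delta>: "triangulation_of \<Delta> real_projective_plane"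
proof -
  have "quotient_map (top_of_set unit_sphere) (top_of_set (body \<Delta>)) octahedral_map"
  proof (rule continuous_imp_quotient_map)
    show "continuous_map (top_of_set unit_sphere) (top_of_set (body \<Delta>)) octahedral_map"
      using continuous_on_octahedral_map octahedral_map_in_body by auto
    have "Hausdorff_space (powertop_real (UNIV :: vertex set))"
      by (simp add: Hausdorff_space_product_topology)
    then show "Hausdorff_space (top_of_set (body \<Delta>))"
      by (simp add: euclidean_product_topology Hausdorff_space_subtopology)
  qed (auto simp: compact_space_subtopology octahedral_map_surjective)
  then have "top_of_set (body \<Delta>) homeomorphic_space top_of_set veronese_surface"
    by (rule homeomorphic_space_quotients_same_fibres[OF _ quotient_map_veronese])
      (auto simp: octahedral_map_eq_iff)
  then have "geometric_realization \<Delta> homeomorphic_space real_projective_plane"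
    using real_projective_plane_homeomorphic_veronese_surface
    unfolding geometric_realization_eq_body[OF complex_\<Delta>]
    by (meson homeomorphic_space_sym homeomorphic_space_trans)
  then show ?thesis using complex_\<Delta> by (simp add: triangulation_of_def)
qed

section \<open>The theorem\<close>

theorem lemma4p1:
  shows "abstract_simplicial_complex \<Delta> \<and> complex_dim \<Delta> = 2 \<and>
    f_number (-1) \<Delta> = 1 \<and> f_number 0 \<Delta> = 9 \<and> f_number 1 \<Delta> = 24 \<and> f_number 2 \<Delta> = 16 \<and>
    balanced \<Delta> \<and> triangulation_of \<Delta> real_projective_plane \<and>
    (\<forall>\<Gamma> :: 'a set set. balanced \<Gamma> \<and> triangulation_of \<Gamma> real_projective_plane \<longrightarrow>
       (\<forall>i\<in>{0, 1, 2}. f_number i \<Gamma> \<ge> f_number i \<Delta>))"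
proof (intro conjI allI impI)
  fix \<Gamma> :: "'a set set"
  assume "balanced \<Gamma> \<and> triangulation_of \<Gamma> real_projective_plane"
  then have "9 \<le> f_number 0 \<Gamma> \<and> 24 \<le> f_number 1 \<Gamma> \<and> 16 \<le> f_number 2 \<Gamma>"
    using balanced_projective_plane_bounds by blast
  then show "\<forall>i\<in>{0, 1, 2}. f_number i \<Gamma> \<ge> f_number i \<Delta>"
    by (simp add: f_numbers_\<Delta>)
qed (rule complex_\<Delta> complex_dim_\<Delta> f_numbers_\<Delta> balanced_\<Delta> triangulation_\<Delta>)+

end
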